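(* Let $O=(p\colon X^*\to E^* )$ be an origami and let $f\in\operatorname{Aff}^+(X)$ be such that $A:=\operatorname{der}(f)$ is hyperbolic. Let $g$ be the genus of $X$ and let $M_f\in\mathbb{Z}^{2g\times 2g}$ be the transformation matrix of the map on $H_1(X,\mathbb{Z})$ induced by $f$. Then the two eigenvalues of $A$ are also eigenvalues of $M_f$, viewed as a matrix in $\mathbb{R}^{2g\times 2g}$.
   Context: An origami $O$ is given by finitely many Euclidean unit squares such that every right side is glued by a translation to a left side, every upper side is glued by a translation to a lower side, and the resulting closed surface $X$ is connected. Sending each square to the torus $E=\mathbb{C}/(\mathbb{Z}+i\mathbb{Z})$ gives a finite covering $p\colon X\to E$ ramified at most over the point $\infty\in E$ that is the image of the vertices. Put $E^*=E\setminus\{\infty\}$, $X^*=X\setminus p^{-1}(\infty)$; the origami is denoted $O=(p\colon X^*\to E^* )$. The surface $X^*$ carries the translation structure pulled back from $E$. $\operatorname{Aff}^+(X)$ is the group of orientation preserving homeomorphisms of $X$ that preserve $X^*$ and are affine with respect to this translation structure, i.e. of the form $z\mapsto Az+t$ in its charts with $A\in\mathrm{SL}_2(\mathbb{R})$ (independent of the chart); $\operatorname{der}(f):=A$. $M_f$ is the matrix of the automorphism of $H_1(X,\mathbb{Z})\cong\pi_1(X)^{ab}\cong\mathbb{Z}^{2g}$ induced by $f$, with respect to the basis given by generators $a_1,\dots,a_g,b_1,\dots,b_g$ with $\pi_1(X)=\langle a_1,b_1,\dots,a_g,b_g\mid\prod_{i=1}^g[a_i,b_i]\rangle$. Hyperbolic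 means $|\operatorname{tr}A|>2$. *)

theory Defs
  imports "HOL-Homology.Homology" "Jordan_Normal_Form.Char_Poly"
begin

definition quotient_topology :: "'a topology \<Rightarrow> ('a \<Rightarrow> 'b) \<Rightarrow> 'b topology" where
  "quotient_topology X q =
     topology (\<lambda>U. U \<subseteq> q ` topspace X \<and> openin X {x \<in> topspace X. q x \<in> U})"

lemma openin_quotient_topology:
  "openin (quotient_topology X q) U \<longleftrightarrow>
     U \<subseteq> q ` topspace X \<and> openin X {x \<in> topspace X. q x \<in> U}"
proof -
  have "istopology (\<lambda>U. U \<subseteq> q ` topspace X \<and> openin X {x \<in> topspace X. q x \<in> U})"
    unfolding istopology_def
  proof (intro conjI allI impI)
    fix S T
    assume S: "S \<subseteq> q ` topspace X \<and> openin X {x \<in> topspace X. q x \<in> S}"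
      and T: "T \<subseteq> q ` topspace X \<and> openin X {x \<in> topspace X. q x \<in> T}"
    have "{x \<in> topspace X. q x \<in> S \<inter> T} =
        {x \<in> topspace X. q x \<in> S} \<inter> {x \<in> topspace X. q x \<in> T}" by auto
    then show "openin X {x \<in> topspace X. q x \<in> S \<inter> T}" using S T by auto
    show "S \<inter> T \<subseteq> q ` topspace X" using S by auto
  next
    fix K
    assume K: "\<forall>U\<in>K. U \<subseteq> q ` topspace X \<and> openin X {x \<in> topspace X. q x \<in> U}"
    have "{x \<in> topspace X. q x \<in> \<Union>K} = (\<Union>U\<in>K. {x \<in> topspace X. q x \<in> U})" by auto
    then show "openin X {x \<in> topspace X. q x \<in> \<Union>K}" using K by auto
    show "\<Union>K \<subseteq> q ` topspace X" using K by auto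
  qed
  then show ?thesis by (simp add: quotient_topology_def)
qed

lemma topspace_quotient_topology [simp]:
  "topspace (quotient_topology X q) = q ` topspace X"
proof
  show "topspace (quotient_topology X q) \<subseteq> q ` topspace X"
    using openin_topspace[of "quotient_topology X q"] unfolding openin_quotient_topology by simp
  have "{x \<in> topspace X. q x \<in> q ` topspace X} = topspace X" by auto
  then have "openin (quotient_topology X q) (q ` topspace X)"
    by (simp add: openin_quotient_topology)
  then show "q ` topspace X \<subseteq> topspace (quotient_topology X q)"
    by (rule openin_subset)
qed

lemma quotient_map_quotient_topology: "quotient_map X (quotient_topology X q) q"
  by (simp add: quotient_map_def openin_quotient_topology)

text \<open>Gluing data: the right side of the square \<open>s\<close> is glued to the left side of
  \<open>right_of Q s\<close>, its upper side to the lower side of \<open>above Q s\<close>.\<close>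

record 's origami_data =
  squares :: "'s set"
  right_of :: "'s \<Rightarrow> 's"
  above :: "'s \<Rightarrow> 's"

definition square_union :: "'s origami_data \<Rightarrow> ('s \<times> complex) topology" where
  "square_union Q =
     prod_topology (discrete_topology (squares Q)) (top_of_set (cbox 0 (Complex 1 1)))"

inductive glue :: "'s origami_data \<Rightarrow> 's \<times> complex \<Rightarrow> 's \<times> complex \<Rightarrow> bool" for Q where
  horizontal: "s \<in> squares Q \<Longrightarrow> 0 \<le> y \<Longrightarrow> y \<le> 1 \<Longrightarrow>
     glue Q (s, Complex 1 y) (right_of Q s, Complex 0 y)"
| vertical: "s \<in> squares Q \<Longrightarrow> 0 \<le> x \<Longrightarrow> x \<le> 1 \<Longrightarrow>
     glue Q (s, Complex x 1) (above Q s, Complex x 0)"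

definition glued_point :: "'s origami_data \<Rightarrow> 's \<times> complex \<Rightarrow> ('s \<times> complex) set" where
  "glued_point Q a = {b. equivclp (glue Q) a b}"

text \<open>The closed surface \<open>X\<close>.\<close>

definition surface :: "'s origami_data \<Rightarrow> ('s \<times> complex) set topology" where
  "surface Q = quotient_topology (square_union Q) (glued_point Q)"

definition origami :: "'s origami_data \<Rightarrow> bool" where
  "origami Q \<longleftrightarrow>
     finite (squares Q) \<and> squares Q \<noteq> {} \<and>
     bij_betw (right_of Q) (squares Q) (squares Q) \<and>
     bij_betw (above Q) (squares Q) (squares Q) \<and>
     connected_space (surface Q)"

text \<open>The projection of \<open>\<complex>\<close> onto the torus \<open>E = \<complex> / (\<int> + \<i>\<int>)\<close>.\<close>

definition torus_class :: "complex \<Rightarrow> complex set" where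
  "torus_class z = {w. Re (w - z) \<in> \<int> \<and> Im (w - z) \<in> \<int>}"

text \<open>The map \<open>p : X \<rightarrow> E\<close>; by \<open>covering_glued_point\<close> it does not depend on the representative.\<close>

definition covering :: "'s origami_data \<Rightarrow> ('s \<times> complex) set \<Rightarrow> complex set" where
  "covering Q P = the_elem ((\<lambda>(s, z). torus_class z) ` P)"

lemma torus_class_eq:
  assumes "Re (w - z) \<in> \<int>" and "Im (w - z) \<in> \<int>"
  shows "torus_class z = torus_class w"
proof -
  have *: "x - a \<in> \<int> \<longleftrightarrow> x - b \<in> \<int>" if "b - a \<in> \<int>" for x a b :: real
  proof
    assume "x - a \<in> \<int>"
    then have "(x - a) - (b - a) \<in> \<int>" using that by (rule Ints_diff)
    then show "x - b \<in> \<int>" by simp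
  next
    assume "x - b \<in> \<int>"
    then have "(x - b) + (b - a) \<in> \<int>" using that by (rule Ints_add)
    then show "x - a \<in> \<int>" by simp
  qed
  show ?thesis
    using *[of "Re w" "Re z"] *[of "Im w" "Im z"] assms by (auto simp: torus_class_def)
qed

lemma covering_glued_point: "covering Q (glued_point Q (s, z)) = torus_class z"
proof -
  have glue_torus: "torus_class (snd a) = torus_class (snd b)" if "glue Q a b" for a b
    using that by (cases rule: glue.cases) (simp_all add: torus_class_eq)
  have "torus_class (snd b) = torus_class (snd a)" if "equivclp (glue Q) a b" for a b
    using that
  proof (induction rule: equivclp_induct)
    case base
    show ?case by (rule refl)
  next
    case (step y z)
    from step.hyps(2) have "torus_class (snd y) = torus_class (snd z)"
      using glue_torus by metis
    with step.IH show ?case by simp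
  qed
  then have const: "torus_class (snd b) = torus_class z" if "b \<in> glued_point Q (s, z)" for b
    using that unfolding glued_point_def by fastforce
  have "(s, z) \<in> glued_point Q (s, z)" by (simp add: glued_point_def)
  with const have "(\<lambda>(s, z). torus_class z) ` glued_point Q (s, z) = {torus_class z}"
    unfolding case_prod_beta by blast
  then show ?thesis by (simp add: covering_def)
qed

text \<open>The point \<open>\<infinity>\<close> of \<open>E\<close> is \<open>torus_class 0\<close>.\<close>

definition vertices :: "'s origami_data \<Rightarrow> ('s \<times> complex) set set" where
  "vertices Q = {P \<in> topspace (surface Q). covering Q P = torus_class 0}"

definition punctured_surface :: "'s origami_data \<Rightarrow> ('s \<times> complex) set set" where
  "punctured_surface Q = topspace (surface Q) - vertices Q"

text \<open>The genus, from the Euler characteristic \<open>2 - 2g = |V| - |E| + |F|\<close> of the square tiling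
  of \<open>X\<close>, which has \<open>n\<close> faces, \<open>2n\<close> edges and the points over \<open>\<infinity>\<close> as vertices.\<close>

definition genus :: "'s origami_data \<Rightarrow> nat" where
  "genus Q = nat ((2 - (int (card (vertices Q)) - 2 * int (card (squares Q))
                         + int (card (squares Q)))) div 2)"

text \<open>Charts of the translation structure pulled back from \<open>E\<close>: the coordinates \<open>\<phi>\<close> on open
  subsets of \<open>X\<^sup>*\<close> that lift \<open>p\<close> along \<open>\<complex> \<rightarrow> E\<close>.\<close>

definition translation_chart ::
  "'s origami_data \<Rightarrow> ('s \<times> complex) set set \<Rightarrow> (('s \<times> complex) set \<Rightarrow> complex) \<Rightarrow> bool" where
  "translation_chart Q U \<phi> \<longleftrightarrow>
     openin (surface Q) U \<and> U \<subseteq> punctured_surface Q \<and> open (\<phi> ` U) \<and>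
     homeomorphic_map (subtopology (surface Q) U) (top_of_set (\<phi> ` U)) \<phi> \<and>
     (\<forall>P\<in>U. torus_class (\<phi> P) = covering Q P)"

text \<open>The group \<open>SL\<^sub>2(\<real>)\<close> and its action on \<open>\<complex> = \<real>\<^sup>2\<close>.\<close>

definition SL2R :: "real mat set" where
  "SL2R = {A \<in> carrier_mat 2 2. Determinant.det A = 1}"

definition linear_action :: "real mat \<Rightarrow> complex \<Rightarrow> complex" where
  "linear_action A z =
     Complex (A $$ (0,0) * Re z + A $$ (0,1) * Im z) (A $$ (1,0) * Re z + A $$ (1,1) * Im z)"

text \<open>The translation part may depend on the charts and on the component of the overlap, the
  linear part may not.\<close>

definition affine_with :: "'s origami_data \<Rightarrow> real mat \<Rightarrow>
    (('s \<times> complex) set \<Rightarrow> ('s \<times> complex) set) \<Rightarrow> bool" where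
  "affine_with Q A f \<longleftrightarrow>
     (\<forall>U \<phi> V \<psi> P. translation_chart Q U \<phi> \<and> translation_chart Q V \<psi> \<and> P \<in> U \<and> f P \<in> V \<longrightarrow>
        (\<exists>W t. openin (surface Q) W \<and> P \<in> W \<and> W \<subseteq> U \<and> f ` W \<subseteq> V \<and>
               (\<forall>R\<in>W. \<psi> (f R) = linear_action A (\<phi> R) + t)))"

text \<open>\<open>Aff\<^sup>+(X)\<close>. As \<open>det A = 1\<close>, these homeomorphisms preserve the orientation.\<close>

definition Aff_plus ::
  "'s origami_data \<Rightarrow> (('s \<times> complex) set \<Rightarrow> ('s \<times> complex) set) set" where
  "Aff_plus Q = {f. homeomorphic_map (surface Q) (surface Q) f \<and>
      f ` punctured_surface Q = punctured_surface Q \<and> (\<exists>A\<in>SL2R. affine_with Q A f)}"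

definition der ::
  "'s origami_data \<Rightarrow> (('s \<times> complex) set \<Rightarrow> ('s \<times> complex) set) \<Rightarrow> real mat" where
  "der Q f = (THE A. A \<in> SL2R \<and> affine_with Q A f)"

definition hyperbolic :: "real mat \<Rightarrow> bool" where
  "hyperbolic A \<longleftrightarrow> \<bar>A $$ (0,0) + A $$ (1,1)\<bar> > 2"

text \<open>Ordered \<open>\<int>\<close>-bases \<open>c 0, \<dots>, c (n - 1)\<close> of an abelian group (written multiplicatively, as
  the homology groups of the library are).\<close>

definition lin_comb :: "('g, 'b) monoid_scheme \<Rightarrow> nat \<Rightarrow> (nat \<Rightarrow> 'g) \<Rightarrow> (nat \<Rightarrow> int) \<Rightarrow> 'g" where
  "lin_comb G n c k = finprod G (\<lambda>i. c i [^]\<^bsub>G\<^esub> k i) {..<n}"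

definition Z_basis :: "('g, 'b) monoid_scheme \<Rightarrow> nat \<Rightarrow> (nat \<Rightarrow> 'g) \<Rightarrow> bool" where
  "Z_basis G n c \<longleftrightarrow>
     (\<forall>i<n. c i \<in> carrier G) \<and>
     (\<forall>x\<in>carrier G. \<exists>!k. k \<in> {..<n} \<rightarrow>\<^sub>E UNIV \<and> x = lin_comb G n c k)"

definition Z_coords :: "('g, 'b) monoid_scheme \<Rightarrow> nat \<Rightarrow> (nat \<Rightarrow> 'g) \<Rightarrow> 'g \<Rightarrow> nat \<Rightarrow> int" where
  "Z_coords G n c x = (THE k. k \<in> {..<n} \<rightarrow>\<^sub>E UNIV \<and> x = lin_comb G n c k)"

text \<open>The matrix \<open>M\<^sub>f\<close> of the map induced on \<open>H\<^sub>1(X, \<int>)\<close>, with respect to the basis \<open>c\<close>.\<close>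

definition homology_matrix :: "'s origami_data \<Rightarrow> (nat \<Rightarrow> ('s \<times> complex) set chain set) \<Rightarrow>
    (('s \<times> complex) set \<Rightarrow> ('s \<times> complex) set) \<Rightarrow> int mat" where
  "homology_matrix Q c f =
     Matrix.mat (2 * genus Q) (2 * genus Q)
       (\<lambda>(i, j). Z_coords (homology_group 1 (surface Q)) (2 * genus Q) c
                   (hom_induced 1 (surface Q) {} (surface Q) {} f (c j)) i)"

end

theory Submission
  imports Defs "HOL-Analysis.Further_Topology"
begin

text \<open>Integrating the \<open>1\<close>-form \<open>dz\<close> of the translation structure gives the holonomy homomorphism
  \<open>H\<^sub>1(X, \<int>) \<rightarrow> \<complex> = \<real>\<^sup>2\<close>. An affine map \<open>f\<close> with linear part \<open>A\<close> satisfies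
  \<open>hol (f\<^sub>* \<gamma>) = A (hol \<gamma>)\<close>. If \<open>H\<close> denotes the real \<open>2 \<times> 2g\<close> matrix of the holonomies of the given
  basis, this reads \<open>H M\<^sub>f = A H\<close>. A left eigenvector \<open>v\<close> of \<open>A\<close> for the eigenvalue \<open>\<mu>\<close> therefore gives
  \<open>(v H) M\<^sub>f = \<mu> (v H)\<close>, and \<open>v H \<noteq> 0\<close> because \<open>H\<close> has rank \<open>2\<close>: there are cycles crossing the squares
  horizontally and vertically, with nonzero holonomy in \<open>\<real>\<close> and in \<open>\<i> \<real>\<close>
  (\<open>functional_vanishing_on_basis\<close>). So every eigenvalue of \<open>A\<close> is an eigenvalue of \<open>M\<^sub>f\<close>, and a
  hyperbolic matrix of determinant \<open>1\<close> has two different real ones.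

  Singular simplices are merely continuous, so the integral is defined as the displacement of a lift of
  \<open>p \<circ> \<sigma>\<close> along \<open>\<complex> \<rightarrow> E\<close>. Lifts over convex sets exist because the functions
  \<open>exp (2 \<pi> \<i> x)\<close> and \<open>exp (2 \<pi> \<i> y)\<close> of the coordinates are well defined on \<open>X\<close> and have continuous
  logarithms there (\<open>torus_lift_exists\<close>); lifting \<open>2\<close>-simplices shows that boundaries have holonomy \<open>0\<close>
  (\<open>holonomy_boundary\<close>).

  The transformation law is proved for each single path \<open>u\<close> in \<open>X\<close> (\<open>affine_lift_difference\<close>): if \<open>L\<close>
  lifts \<open>u\<close> and \<open>L'\<close> lifts \<open>f \<circ> u\<close>, then \<open>L' - A L\<close> is constant. Over \<open>X\<^sup>*\<close> it is locally constant, by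
  the affine form of \<open>f\<close> in charts, and over the vertices it takes values in a countable set; a
  continuous function on an interval with countable image is constant. This needs a translation chart
  around every point of \<open>X\<^sup>*\<close>, also on the sides of the squares (\<open>translation_chart_exists\<close>).\<close>

section \<open>Lifting maps into the surface to the plane\<close>

lemma torus_class_eq_iff:
  "torus_class z = torus_class w \<longleftrightarrow> Re (w - z) \<in> \<int> \<and> Im (w - z) \<in> \<int>"
proof
  assume "torus_class z = torus_class w"
  moreover have "w \<in> torus_class w" by (simp add: torus_class_def)
  ultimately show "Re (w - z) \<in> \<int> \<and> Im (w - z) \<in> \<int>"
    by (metis (mono_tags, lifting) mem_Collect_eq torus_class_def)
qed (use torus_class_eq in blast)

lemma topspace_square_union:
  "topspace (square_union Q) = squares Q \<times> cbox 0 (Complex 1 1)"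
  by (simp add: square_union_def)

lemma topspace_surface:
  "topspace (surface Q) = glued_point Q ` (squares Q \<times> cbox 0 (Complex 1 1))"
  by (simp add: surface_def topspace_square_union)

lemma surface_point_cases:
  assumes "P \<in> topspace (surface Q)"
  obtains s z where "s \<in> squares Q" "z \<in> cbox 0 (Complex 1 1)" "P = glued_point Q (s, z)"
    "covering Q P = torus_class z"
proof -
  from assms obtain s z where "s \<in> squares Q" "z \<in> cbox 0 (Complex 1 1)" "P = glued_point Q (s, z)"
    unfolding topspace_surface by blast
  with that show ?thesis using covering_glued_point by metis
qed

lemma countable_lattice: "countable {z. Re z \<in> \<int> \<and> Im z \<in> \<int>}"
proof -
  have "{z. Re z \<in> \<int> \<and> Im z \<in> \<int>} \<subseteq> (\<lambda>(a, b). Complex a b) ` (\<int> \<times> \<int>)"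
    by (auto simp: image_iff) (metis complex.collapse)
  moreover have "countable ((\<lambda>(a, b). Complex a b) ` ((\<int>::real set) \<times> (\<int>::real set)))"
    by (intro countable_image countable_SIGMA countable_int)
  ultimately show ?thesis by (rule countable_subset)
qed

text \<open>A connected metric space with two points is uncountable. This replaces every discreteness
  argument below, in particular where the values are only known to lie in \<open>\<Lambda> + A \<Lambda>\<close> for the lattice
  \<open>\<Lambda> = \<int> + \<i>\<int>\<close>, a set that need not be discrete when nothing is known about \<open>A\<close>.\<close>

lemma constant_if_countable_image:
  fixes D :: "'a::topological_space \<Rightarrow> 'b::metric_space"
  assumes "connected S" "continuous_on S D" "countable (D ` S)" "x \<in> S" "y \<in> S"
  shows "D x = D y"
proof (rule ccontr)
  assume "D x \<noteq> D y"
  moreover have "connected (D ` S)" using assms connected_continuous_image by blast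
  ultimately have "uncountable (D ` S)" using assms connected_uncountable by blast
  with assms show False by blast
qed

text \<open>Lifts of \<open>p \<circ> u\<close> along \<open>\<complex> \<rightarrow> E\<close>. The condition is phrased with \<^const>\<open>torus_class\<close>, so that
  \<open>E\<close> needs no topology of its own.\<close>

definition torus_lift ::
  "'s origami_data \<Rightarrow> 'v::topological_space set \<Rightarrow> ('v \<Rightarrow> ('s \<times> complex) set) \<Rightarrow> ('v \<Rightarrow> complex) \<Rightarrow> bool"
  where "torus_lift Q S u L \<longleftrightarrow>
    continuous_on S L \<and> (\<forall>x\<in>S. torus_class (L x) = covering Q (u x))"

lemma torus_lift_unique:
  assumes "connected S" "torus_lift Q S u L" "torus_lift Q S u L'" "x \<in> S" "y \<in> S"
  shows "L' x - L x = L' y - L y"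
proof (rule constant_if_countable_image[OF assms(1) _ _ assms(4,5)])
  show "continuous_on S (\<lambda>x. L' x - L x)"
    using assms by (auto simp: torus_lift_def intro!: continuous_intros)
  have "torus_class (L x) = torus_class (L' x)" if "x \<in> S" for x
    using assms that by (simp add: torus_lift_def)
  then have "(\<lambda>x. L' x - L x) ` S \<subseteq> {z. Re z \<in> \<int> \<and> Im z \<in> \<int>}"
    unfolding torus_class_eq_iff by auto
  then show "countable ((\<lambda>x. L' x - L x) ` S)"
    using countable_lattice countable_subset by blast
qed

lemma exp_2pi_of_int_diff:
  fixes x y :: real
  assumes "x - y \<in> \<int>"
  shows "exp (2 * of_real pi * \<i> * of_real x) = exp (2 * of_real pi * \<i> * of_real y)"
proof -
  obtain n where "x - y = of_int n" using assms by (auto elim: Ints_cases)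
  then have "x = y + of_int n" by simp
  then show ?thesis
    unfolding exp_eq by (intro exI[of _ n]) (simp add: algebra_simps)
qed

text \<open>A coordinate of a point of \<open>X\<close> is defined modulo \<open>1\<close>, so its exponential is a map on \<open>X\<close>. The
  choice of a representative is harmless for the same reason; continuity descends from the squares
  because \<open>X\<close> carries the quotient topology.\<close>

lemma continuous_coordinate_character:
  fixes r :: "complex \<Rightarrow> real"
  assumes r: "continuous_on UNIV r"
    and int: "\<And>z w. torus_class z = torus_class w \<Longrightarrow> r z - r w \<in> \<int>"
  shows "continuous_map (surface Q) euclidean
           (\<lambda>P. exp (2 * of_real pi * \<i> * of_real (r (SOME z. torus_class z = covering Q P))))"
    (is "continuous_map _ _ ?e")
proof (rule continuous_compose_quotient_map)
  show "quotient_map (square_union Q) (surface Q) (glued_point Q)"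
    unfolding surface_def by (rule quotient_map_quotient_topology)
  have eq: "exp (2 * of_real pi * \<i> * of_real (r (snd a))) = (?e \<circ> glued_point Q) a" for a
  proof -
    obtain s z where a: "a = (s, z)" by (cases a)
    have "torus_class (SOME w. torus_class w = torus_class z) = torus_class z"
      by (rule someI[of "\<lambda>w. torus_class w = torus_class z"]) simp
    then have "r (SOME w. torus_class w = torus_class z) - r z \<in> \<int>" by (rule int)
    then show ?thesis using a by (simp add: covering_glued_point exp_2pi_of_int_diff)
  qed
  have "continuous_map (square_union Q) (top_of_set (cbox 0 (Complex 1 1))) snd"
    unfolding square_union_def by (rule continuous_map_snd)
  then have "continuous_map (square_union Q) euclidean snd"
    by (rule continuous_map_into_fulltopology)
  moreover have "continuous_map euclidean euclidean (\<lambda>z. exp (2 * of_real pi * \<i> * of_real (r z)))"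
    using r by (auto intro!: continuous_intros simp: continuous_map_iff_continuous2)
  ultimately have "continuous_map (square_union Q) euclidean
      ((\<lambda>z. exp (2 * of_real pi * \<i> * of_real (r z))) \<circ> snd)"
    by (rule continuous_map_compose)
  then show "continuous_map (square_union Q) euclidean (?e \<circ> glued_point Q)"
    by (rule continuous_map_eq) (use eq in simp)
qed

text \<open>On a convex set the nowhere vanishing function \<open>exp (2 \<pi> \<i> r)\<close> has a continuous logarithm, whose
  imaginary part divided by \<open>2 \<pi>\<close> is a lift of the coordinate \<open>r\<close>.\<close>

lemma coordinate_lift:
  fixes r :: "complex \<Rightarrow> real" and S :: "'v::real_normed_vector set"
  assumes r: "continuous_on UNIV r"
    and int: "\<And>z w. torus_class z = torus_class w \<Longrightarrow> r z - r w \<in> \<int>"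
    and S: "convex S" and u: "continuous_map (top_of_set S) (surface Q) u"
  obtains g where "continuous_on S g"
    "\<And>x z. x \<in> S \<Longrightarrow> torus_class z = covering Q (u x) \<Longrightarrow> g x - r z \<in> \<int>"
proof -
  let ?e = "\<lambda>P. exp (2 * of_real pi * \<i> * of_real (r (SOME z. torus_class z = covering Q P)))"
  have "continuous_on S (?e \<circ> u)"
    using continuous_map_compose[OF u continuous_coordinate_character[OF r int]]
    by (simp add: continuous_map_iff_continuous)
  then obtain h where h: "continuous_on S h" "\<And>x. x \<in> S \<Longrightarrow> (?e \<circ> u) x = exp (h x)"
    using continuous_logarithm_on_contractible[of S "?e \<circ> u"] convex_imp_contractible[OF S]
    by auto
  show ?thesis
  proof
    show "continuous_on S (\<lambda>x. Im (h x) / (2 * pi))"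
      using h by (intro continuous_intros) auto
    fix x z assume x: "x \<in> S" and z: "torus_class z = covering Q (u x)"
    let ?w = "SOME z. torus_class z = covering Q (u x)"
    have "torus_class ?w = covering Q (u x)" using z by (rule someI)
    then have 1: "r ?w - r z \<in> \<int>" using z int by simp
    have "exp (2 * of_real pi * \<i> * of_real (r ?w)) = exp (h x)" using h(2)[OF x] by simp
    then obtain n where "2 * of_real pi * \<i> * of_real (r ?w) = h x + of_int (2 * n) * of_real pi * \<i>"
      unfolding exp_eq by auto
    then have "Im (2 * of_real pi * \<i> * of_real (r ?w)) = Im (h x + of_int (2 * n) * of_real pi * \<i>)"
      by simp
    then have "Im (h x) / (2 * pi) = r ?w - of_int n" by (simp add: field_simps)
    then have "Im (h x) / (2 * pi) - r z = (r ?w - r z) - of_int n" by simp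
    then show "Im (h x) / (2 * pi) - r z \<in> \<int>"
      using Ints_diff[OF 1 Ints_of_int[of n]] by (simp only:)
  qed
qed

lemma torus_lift_exists:
  fixes S :: "'v::real_normed_vector set"
  assumes S: "convex S" and u: "continuous_map (top_of_set S) (surface Q) u"
  obtains L where "torus_lift Q S u L"
proof -
  have "Re z - Re w \<in> \<int>" "Im z - Im w \<in> \<int>" if "torus_class z = torus_class w" for z w
    using that[symmetric] unfolding torus_class_eq_iff by auto
  note int = this
  obtain g1 where g1: "continuous_on S g1"
     "\<And>x z. x \<in> S \<Longrightarrow> torus_class z = covering Q (u x) \<Longrightarrow> g1 x - Re z \<in> \<int>"
    using coordinate_lift[OF continuous_on_Re[OF continuous_on_id] int(1) S u] by blast
  obtain g2 where g2: "continuous_on S g2"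
     "\<And>x z. x \<in> S \<Longrightarrow> torus_class z = covering Q (u x) \<Longrightarrow> g2 x - Im z \<in> \<int>"
    using coordinate_lift[OF continuous_on_Im[OF continuous_on_id] int(2) S u] by blast
  have "torus_class (Complex (g1 x) (g2 x)) = covering Q (u x)" if "x \<in> S" for x
  proof -
    have "u x \<in> topspace (surface Q)" using u that by (auto simp: continuous_map_def)
    then obtain z where z: "covering Q (u x) = torus_class z" using surface_point_cases by metis
    have "torus_class z = torus_class (Complex (g1 x) (g2 x))"
      unfolding torus_class_eq_iff using g1(2)[OF that, of z] g2(2)[OF that, of z] z by simp
    then show ?thesis using z by simp
  qed
  then have "torus_lift Q S u (\<lambda>x. Complex (g1 x) (g2 x))"
    unfolding torus_lift_def using g1 g2 by (auto intro: continuous_on_Complex)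
  then show ?thesis by (rule that)
qed

section \<open>Translation charts around every point of the punctured surface\<close>

lemma quotient_map_surface: "quotient_map (square_union Q) (surface Q) (glued_point Q)"
  unfolding surface_def by (rule quotient_map_quotient_topology)

lemma glued_point_eq_iff: "glued_point Q a = glued_point Q b \<longleftrightarrow> equivclp (glue Q) a b"
proof
  assume "glued_point Q a = glued_point Q b"
  moreover have "b \<in> glued_point Q b" by (simp add: glued_point_def)
  ultimately have "b \<in> glued_point Q a" by simp
  then show "equivclp (glue Q) a b" by (simp add: glued_point_def)
next
  assume "equivclp (glue Q) a b"
  then show "glued_point Q a = glued_point Q b"
    unfolding glued_point_def by (blast intro: equivclp_trans equivclp_sym)
qed

lemma glued_point_glue: "glue Q a b \<Longrightarrow> glued_point Q a = glued_point Q b"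
  by (simp add: glued_point_eq_iff r_into_equivclp)

lemma openin_square_union_square:
  assumes "s \<in> squares Q" "open T"
  shows "openin (square_union Q) ({s} \<times> (cbox 0 (Complex 1 1) \<inter> T))"
  unfolding square_union_def openin_prod_Times_iff
  using assms by (auto intro: openin_open_Int)

lemma continuous_map_into_square:
  fixes k :: "'v::topological_space \<Rightarrow> complex"
  assumes "s \<in> squares Q" "continuous_on C k" "k ` C \<subseteq> cbox 0 (Complex 1 1)"
  shows "continuous_map (top_of_set C) (surface Q) (\<lambda>w. glued_point Q (s, k w))"
proof -
  have "continuous_map (top_of_set C) (square_union Q) (\<lambda>w. (s, k w))"
    unfolding square_union_def using assms by (auto simp: continuous_map_pairwise o_def)
  from continuous_map_compose[OF this quotient_imp_continuous_map[OF quotient_map_surface]]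
  show ?thesis by (simp add: o_def)
qed

text \<open>A chart can be described upstairs, on the disjoint squares: by a function \<open>h\<close> on a saturated open
  set that respects the gluing, together with a continuous parametrization \<open>\<psi>\<close> of the image that
  inverts it. Saturation makes the image open in \<open>X\<close>, the quotient topology makes \<open>h\<close> continuous there,
  and \<open>\<psi>\<close> provides the continuous inverse.\<close>

lemma translation_chart_from_squares:
  fixes h :: "complex \<Rightarrow> complex"
  assumes V: "openin (square_union Q) V"
    and sat: "\<And>a b. glue Q a b \<Longrightarrow> a \<in> V \<longleftrightarrow> b \<in> V"
    and glue: "\<And>a b. glue Q a b \<Longrightarrow> a \<in> V \<Longrightarrow> h (snd a) = h (snd b)"
    and conth: "continuous_on (snd ` V) h"
    and lift: "\<And>a. a \<in> V \<Longrightarrow> torus_class (h (snd a)) = torus_class (snd a)"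
    and R: "open R" "(\<lambda>a. h (snd a)) ` V = R"
    and cont\<psi>: "continuous_map (top_of_set R) (surface Q) \<psi>"
    and inv: "\<And>a. a \<in> V \<Longrightarrow> \<psi> (h (snd a)) = glued_point Q a"
    and avoid: "\<And>a. a \<in> V \<Longrightarrow> torus_class (snd a) \<noteq> torus_class 0"
  shows "\<exists>\<phi>. translation_chart Q (glued_point Q ` V) \<phi>"
proof -
  let ?U = "glued_point Q ` V"
  define \<phi> where "\<phi> P = h (snd (SOME a. a \<in> V \<and> glued_point Q a = P))" for P
  have equiv: "b \<in> V \<and> h (snd a) = h (snd b)" if "equivclp (glue Q) a b" "a \<in> V" for a b
    using that
  proof (induction rule: equivclp_induct)
    case (step y z)
    then show ?case using sat glue by metis
  qed simp
  have \<phi>: "\<phi> (glued_point Q a) = h (snd a)" if "a \<in> V" for a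
  proof -
    let ?b = "SOME b. b \<in> V \<and> glued_point Q b = glued_point Q a"
    have "?b \<in> V \<and> glued_point Q ?b = glued_point Q a"
      by (rule someI[of _ a]) (use that in simp)
    then show ?thesis unfolding \<phi>_def using equiv glued_point_eq_iff by metis
  qed
  have Vsub: "V \<subseteq> topspace (square_union Q)" using V by (rule openin_subset)
  have pre: "{x \<in> topspace (square_union Q). glued_point Q x \<in> ?U} = V"
  proof (intro equalityI subsetI)
    fix x assume "x \<in> {x \<in> topspace (square_union Q). glued_point Q x \<in> ?U}"
    then obtain a where "a \<in> V" "glued_point Q a = glued_point Q x" by force
    then show "x \<in> V" using equiv[of a x] by (simp add: glued_point_eq_iff)
  qed (use Vsub in auto)
  have openU: "openin (surface Q) ?U"
    unfolding surface_def openin_quotient_topology using pre V Vsub by auto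
  have \<phi>U: "\<phi> ` ?U = R" using \<phi> R(2) by force
  have quot: "quotient_map (subtopology (square_union Q) V) (subtopology (surface Q) ?U) (glued_point Q)"
    by (rule quotient_map_restriction[OF quotient_map_surface pre]) (use openU in simp)
  have "continuous_map (square_union Q) (top_of_set (cbox 0 (Complex 1 1))) snd"
    unfolding square_union_def by (rule continuous_map_snd)
  then have "continuous_map (subtopology (square_union Q) V) euclidean snd"
    using continuous_map_from_subtopology continuous_map_into_fulltopology by blast
  then have "continuous_map (subtopology (square_union Q) V) (top_of_set (snd ` V)) snd"
    by (rule continuous_map_into_subtopology) auto
  moreover have "continuous_map (top_of_set (snd ` V)) (top_of_set R) h"
    using conth R(2) by auto
  ultimately have "continuous_map (subtopology (square_union Q) V) (top_of_set R) (h \<circ> snd)"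
    by (rule continuous_map_compose)
  then have "continuous_map (subtopology (square_union Q) V) (top_of_set R) (\<phi> \<circ> glued_point Q)"
    by (rule continuous_map_eq) (use \<phi> in auto)
  then have cont\<phi>: "continuous_map (subtopology (surface Q) ?U) (top_of_set R) \<phi>"
    by (rule continuous_compose_quotient_map[OF quot])
  have inv2: "\<psi> (\<phi> P) = P" if "P \<in> ?U" for P using that \<phi> inv by auto
  have inv1: "\<psi> w \<in> ?U \<and> \<phi> (\<psi> w) = w" if w: "w \<in> R" for w
  proof -
    obtain a where "a \<in> V" "w = h (snd a)" using w R(2) by blast
    then show ?thesis using inv \<phi> by simp
  qed
  have "continuous_map (top_of_set R) (subtopology (surface Q) ?U) \<psi>"
    by (rule continuous_map_into_subtopology[OF cont\<psi>]) (use inv1 in auto)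
  then have "homeomorphic_maps (subtopology (surface Q) ?U) (top_of_set R) \<phi> \<psi>"
    unfolding homeomorphic_maps_def using cont\<phi> inv1 inv2 by auto
  then have "homeomorphic_map (subtopology (surface Q) ?U) (top_of_set R) \<phi>"
    unfolding homeomorphic_map_maps by blast
  moreover have "torus_class (\<phi> P) = covering Q P \<and> covering Q P \<noteq> torus_class 0" if P: "P \<in> ?U" for P
  proof -
    obtain a where a: "a \<in> V" "P = glued_point Q a" using P by blast
    then have "covering Q P = torus_class (snd a)" by (metis covering_glued_point prod.collapse)
    then show ?thesis using \<phi>[OF a(1)] lift[OF a(1)] avoid[OF a(1)] a(2) by metis
  qed
  moreover from this have "?U \<subseteq> punctured_surface Q"
    using openin_subset[OF openU] unfolding punctured_surface_def vertices_def by blast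
  ultimately have "translation_chart Q ?U \<phi>"
    unfolding translation_chart_def using openU \<phi>U R(1) by auto
  then show ?thesis by blast
qed

lemma torus_class_eq_0_iff: "torus_class z = torus_class 0 \<longleftrightarrow> Re z \<in> \<int> \<and> Im z \<in> \<int>"
  using torus_class_eq_iff[of 0 z] by auto

lemma not_Ints_between:
  fixes x :: real
  assumes "of_int n < x" "x < of_int n + 1"
  shows "x \<notin> \<int>"
  using assms by (auto elim!: Ints_cases)

lemma open_strips:
  "open {z. a < Re z \<and> Re z < b \<and> c < Im z \<and> Im z < d}"
  by (intro open_Collect_conj open_Collect_less continuous_intros)

lemma translation_chart_square:
  assumes s: "s \<in> squares Q"
  shows "\<exists>\<phi>. translation_chart Q (glued_point Q ` ({s} \<times> box 0 (Complex 1 1))) \<phi>"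
proof (rule translation_chart_from_squares[where h = "\<lambda>z. z" and R = "box 0 (Complex 1 1)"
      and \<psi> = "\<lambda>w. glued_point Q (s, w)"])
  have "cbox 0 (Complex 1 1) \<inter> box 0 (Complex 1 1) = box 0 (Complex 1 1)"
    using box_subset_cbox by blast
  then show "openin (square_union Q) ({s} \<times> box 0 (Complex 1 1))"
    using openin_square_union_square[OF s open_box] by metis
  show "a \<in> {s} \<times> box 0 (Complex 1 1) \<longleftrightarrow> b \<in> {s} \<times> box 0 (Complex 1 1)" if "glue Q a b" for a b
    using that by cases (auto simp: in_box_complex_iff)
  show "snd a = snd b" if "glue Q a b" "a \<in> {s} \<times> box 0 (Complex 1 1)" for a b
    using that by cases (auto simp: in_box_complex_iff)
  show "continuous_map (top_of_set (box 0 (Complex 1 1))) (surface Q) (\<lambda>w. glued_point Q (s, w))"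
    by (rule continuous_map_into_square[OF s]) (auto simp: box_subset_cbox[THEN subsetD] intro: continuous_intros)
  show "torus_class (snd a) \<noteq> torus_class 0" if "a \<in> {s} \<times> box 0 (Complex 1 1)" for a
    using that not_Ints_between[of 0 "Re (snd a)"]
    by (auto simp: torus_class_eq_0_iff in_box_complex_iff)
qed auto

text \<open>Around the open right side of \<open>s\<close> the chart joins the right half of \<open>s\<close> to the left half of its
  neighbour, translated by \<open>1\<close>. Only halves are used because \<open>s\<close> may be its own neighbour, and then
  the full squares would overlap.\<close>

lemma translation_chart_vertical_edge:
  assumes bij: "bij_betw (right_of Q) (squares Q) (squares Q)" and s: "s \<in> squares Q"
  obtains U \<phi> where "translation_chart Q U \<phi>"
    "\<And>y. 0 < y \<Longrightarrow> y < 1 \<Longrightarrow> glued_point Q (s, Complex 1 y) \<in> U"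
proof -
  \<comment> \<open>The outer bounds \<open>2\<close> and \<open>-1\<close> exclude nothing inside a square; they give both pieces the shape of an open rectangle.\<close>
  define V where "V = {s} \<times> (cbox 0 (Complex 1 1) \<inter> {z. 1/2 < Re z \<and> Re z < 2 \<and> 0 < Im z \<and> Im z < 1})
     \<union> {right_of Q s} \<times> (cbox 0 (Complex 1 1) \<inter> {z. - 1 < Re z \<and> Re z < 1/2 \<and> 0 < Im z \<and> Im z < 1})"
  let ?r = "right_of Q s"
  let ?h = "\<lambda>z. if Re z \<le> 1/2 then z + 1 else z"
  let ?R = "{z. 1/2 < Re z \<and> Re z < 3/2 \<and> 0 < Im z \<and> Im z < 1}"
  let ?\<psi> = "\<lambda>w. if Re w \<le> 1 then glued_point Q (s, w) else glued_point Q (?r, w - 1)"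
  have r: "?r \<in> squares Q" using bij s by (rule bij_betwE[THEN bspec])
  have inj: "right_of Q t = ?r \<longleftrightarrow> t = s" if "t \<in> squares Q" for t
    using bij s that by (auto simp: bij_betw_def inj_on_def)
  have "\<exists>\<phi>. translation_chart Q (glued_point Q ` V) \<phi>"
  proof (rule translation_chart_from_squares[where h = ?h and R = ?R and \<psi> = ?\<psi>])
    show "openin (square_union Q) V"
      unfolding V_def by (intro openin_Un openin_square_union_square s r open_strips)
    show "a \<in> V \<longleftrightarrow> b \<in> V" if "glue Q a b" for a b
      using that by cases (auto simp: V_def in_cbox_complex_iff inj)
    show "?h (snd a) = ?h (snd b)" if "glue Q a b" "a \<in> V" for a b
      using that by cases (auto simp: V_def complex_eq_iff)
    have "continuous_on ({z. Re z < 1/2} \<union> {z. Re z > 1/2}) ?h"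
    proof (rule continuous_on_open_Un)
      show "continuous_on {z. Re z < 1/2} ?h"
        by (rule continuous_on_eq[of _ "\<lambda>z. z + 1"]) (auto intro!: continuous_intros)
      show "continuous_on {z. Re z > 1/2} ?h"
        by (rule continuous_on_eq[of _ "\<lambda>z. z"]) (auto intro!: continuous_intros)
    qed (intro open_Collect_less continuous_intros)+
    then show "continuous_on (snd ` V) ?h"
      by (rule continuous_on_subset) (auto simp: V_def)
    show "torus_class (?h (snd a)) = torus_class (snd a)" if "a \<in> V" for a
      by (auto simp: torus_class_eq_iff)
    show "open ?R" by (rule open_strips)
    show "(\<lambda>a. ?h (snd a)) ` V = ?R"
    proof
      show "(\<lambda>a. ?h (snd a)) ` V \<subseteq> ?R"
        by (auto simp: V_def in_cbox_complex_iff)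
      show "?R \<subseteq> (\<lambda>a. ?h (snd a)) ` V"
      proof
        fix w assume w: "w \<in> ?R"
        show "w \<in> (\<lambda>a. ?h (snd a)) ` V"
        proof (cases "Re w \<le> 1")
          case True
          then have "(s, w) \<in> V" using w by (auto simp: V_def in_cbox_complex_iff)
          then show ?thesis using w by (intro image_eqI[of _ _ "(s, w)"]) auto
        next
          case False
          then have "(?r, w - 1) \<in> V" using w by (auto simp: V_def in_cbox_complex_iff)
          then show ?thesis using w by (intro image_eqI[of _ _ "(?r, w - 1)"]) auto
        qed
      qed
    qed
    show "continuous_map (top_of_set ?R) (surface Q) ?\<psi>"
    proof (rule continuous_map_cases_le)
      show "continuous_map (top_of_set ?R) euclideanreal Re"
        by (auto intro!: continuous_intros)
      show "continuous_map (top_of_set ?R) euclideanreal (\<lambda>w. 1)" by simp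
      show "continuous_map (subtopology (top_of_set ?R) {w \<in> topspace (top_of_set ?R). Re w \<le> 1})
              (surface Q) (\<lambda>w. glued_point Q (s, w))"
        unfolding subtopology_subtopology
        by (rule continuous_map_into_square[OF s]) (auto simp: in_cbox_complex_iff intro: continuous_intros)
      show "continuous_map (subtopology (top_of_set ?R) {w \<in> topspace (top_of_set ?R). 1 \<le> Re w})
              (surface Q) (\<lambda>w. glued_point Q (?r, w - 1))"
        unfolding subtopology_subtopology
        by (rule continuous_map_into_square[OF r]) (auto simp: in_cbox_complex_iff intro!: continuous_intros)
      show "glued_point Q (s, w) = glued_point Q (?r, w - 1)"
        if "w \<in> topspace (top_of_set ?R)" "Re w = 1" for w
      proof (rule glued_point_glue)
        have "w = Complex 1 (Im w)" "w - 1 = Complex 0 (Im w)" using that by (auto simp: complex_eq_iff)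
        then show "glue Q (s, w) (?r, w - 1)" using glue.horizontal[OF s, of "Im w"] that by auto
      qed
    qed
    show "?\<psi> (?h (snd a)) = glued_point Q a" if aV: "a \<in> V" for a
    proof -
      obtain t z where a: "a = (t, z)" by (cases a)
      consider "t = s" "1/2 < Re z" "Re z \<le> 1"
        | "t = ?r" "0 \<le> Re z" "Re z < 1/2" "0 < Im z" "Im z < 1"
        using aV a by (auto simp: V_def in_cbox_complex_iff)
      then show ?thesis
      proof cases
        case 2
        show ?thesis
        proof (cases "Re z = 0")
          case True
          have "z = Complex 0 (Im z)" "z + 1 = Complex 1 (Im z)" using True by (auto simp: complex_eq_iff)
          then have "glue Q (s, z + 1) (?r, z)" using glue.horizontal[OF s, of "Im z"] 2 by auto
          from glued_point_glue[OF this] show ?thesis using a 2 True by simp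
        qed (use a 2 in auto)
      qed (use a in auto)
    qed
    show "torus_class (snd a) \<noteq> torus_class 0" if "a \<in> V" for a
      using that not_Ints_between[of 0 "Im (snd a)"] by (auto simp: V_def torus_class_eq_0_iff)
  qed
  then obtain \<phi> where "translation_chart Q (glued_point Q ` V) \<phi>" ..
  moreover have "glued_point Q (s, Complex 1 y) \<in> glued_point Q ` V" if "0 < y" "y < 1" for y
    using that by (intro imageI) (auto simp: V_def in_cbox_complex_iff)
  ultimately show ?thesis by (rule that)
qed

text \<open>The same construction around the open upper side of \<open>s\<close>, with translation by \<open>\<i>\<close>.\<close>

lemma translation_chart_horizontal_edge:
  assumes bij: "bij_betw (above Q) (squares Q) (squares Q)" and s: "s \<in> squares Q"
  obtains U \<phi> where "translation_chart Q U \<phi>"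
    "\<And>y. 0 < y \<Longrightarrow> y < 1 \<Longrightarrow> glued_point Q (s, Complex y 1) \<in> U"
proof -
  define V where "V = {s} \<times> (cbox 0 (Complex 1 1) \<inter> {z. 0 < Re z \<and> Re z < 1 \<and> 1/2 < Im z \<and> Im z < 2})
     \<union> {above Q s} \<times> (cbox 0 (Complex 1 1) \<inter> {z. 0 < Re z \<and> Re z < 1 \<and> - 1 < Im z \<and> Im z < 1/2})"
  let ?r = "above Q s"
  let ?h = "\<lambda>z. if Im z \<le> 1/2 then z + \<i> else z"
  let ?R = "{z. 0 < Re z \<and> Re z < 1 \<and> 1/2 < Im z \<and> Im z < 3/2}"
  let ?\<psi> = "\<lambda>w. if Im w \<le> 1 then glued_point Q (s, w) else glued_point Q (?r, w - \<i>)"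
  have r: "?r \<in> squares Q" using bij s by (rule bij_betwE[THEN bspec])
  have inj: "above Q t = ?r \<longleftrightarrow> t = s" if "t \<in> squares Q" for t
    using bij s that by (auto simp: bij_betw_def inj_on_def)
  have "\<exists>\<phi>. translation_chart Q (glued_point Q ` V) \<phi>"
  proof (rule translation_chart_from_squares[where h = ?h and R = ?R and \<psi> = ?\<psi>])
    show "openin (square_union Q) V"
      unfolding V_def by (intro openin_Un openin_square_union_square s r open_strips)
    show "a \<in> V \<longleftrightarrow> b \<in> V" if "glue Q a b" for a b
      using that by cases (auto simp: V_def in_cbox_complex_iff inj)
    show "?h (snd a) = ?h (snd b)" if "glue Q a b" "a \<in> V" for a b
      using that by cases (auto simp: V_def complex_eq_iff)
    have "continuous_on ({z. Im z < 1/2} \<union> {z. Im z > 1/2}) ?h"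
    proof (rule continuous_on_open_Un)
      show "continuous_on {z. Im z < 1/2} ?h"
        by (rule continuous_on_eq[of _ "\<lambda>z. z + \<i>"]) (auto intro!: continuous_intros)
      show "continuous_on {z. Im z > 1/2} ?h"
        by (rule continuous_on_eq[of _ "\<lambda>z. z"]) (auto intro!: continuous_intros)
    qed (intro open_Collect_less continuous_intros)+
    then show "continuous_on (snd ` V) ?h"
      by (rule continuous_on_subset) (auto simp: V_def)
    show "torus_class (?h (snd a)) = torus_class (snd a)" if "a \<in> V" for a
      by (auto simp: torus_class_eq_iff)
    show "open ?R" by (rule open_strips)
    show "(\<lambda>a. ?h (snd a)) ` V = ?R"
    proof
      show "(\<lambda>a. ?h (snd a)) ` V \<subseteq> ?R"
        by (auto simp: V_def in_cbox_complex_iff)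
      show "?R \<subseteq> (\<lambda>a. ?h (snd a)) ` V"
      proof
        fix w assume w: "w \<in> ?R"
        show "w \<in> (\<lambda>a. ?h (snd a)) ` V"
        proof (cases "Im w \<le> 1")
          case True
          then have "(s, w) \<in> V" using w by (auto simp: V_def in_cbox_complex_iff)
          then show ?thesis using w by (intro image_eqI[of _ _ "(s, w)"]) auto
        next
          case False
          then have "(?r, w - \<i>) \<in> V" using w by (auto simp: V_def in_cbox_complex_iff)
          then show ?thesis using w by (intro image_eqI[of _ _ "(?r, w - \<i>)"]) auto
        qed
      qed
    qed
    show "continuous_map (top_of_set ?R) (surface Q) ?\<psi>"
    proof (rule continuous_map_cases_le)
      show "continuous_map (top_of_set ?R) euclideanreal Im"
        by (auto intro!: continuous_intros)
      show "continuous_map (top_of_set ?R) euclideanreal (\<lambda>w. 1)" by simp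
      show "continuous_map (subtopology (top_of_set ?R) {w \<in> topspace (top_of_set ?R). Im w \<le> 1})
              (surface Q) (\<lambda>w. glued_point Q (s, w))"
        unfolding subtopology_subtopology
        by (rule continuous_map_into_square[OF s]) (auto simp: in_cbox_complex_iff intro: continuous_intros)
      show "continuous_map (subtopology (top_of_set ?R) {w \<in> topspace (top_of_set ?R). 1 \<le> Im w})
              (surface Q) (\<lambda>w. glued_point Q (?r, w - \<i>))"
        unfolding subtopology_subtopology
        by (rule continuous_map_into_square[OF r]) (auto simp: in_cbox_complex_iff intro!: continuous_intros)
      show "glued_point Q (s, w) = glued_point Q (?r, w - \<i>)"
        if "w \<in> topspace (top_of_set ?R)" "Im w = 1" for w
      proof (rule glued_point_glue)
        have "w = Complex (Re w) 1" "w - \<i> = Complex (Re w) 0" using that by (auto simp: complex_eq_iff)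
        then show "glue Q (s, w) (?r, w - \<i>)" using glue.vertical[OF s, of "Re w"] that by auto
      qed
    qed
    show "?\<psi> (?h (snd a)) = glued_point Q a" if aV: "a \<in> V" for a
    proof -
      obtain t z where a: "a = (t, z)" by (cases a)
      consider "t = s" "1/2 < Im z" "Im z \<le> 1"
        | "t = ?r" "0 \<le> Im z" "Im z < 1/2" "0 < Re z" "Re z < 1"
        using aV a by (auto simp: V_def in_cbox_complex_iff)
      then show ?thesis
      proof cases
        case 2
        show ?thesis
        proof (cases "Im z = 0")
          case True
          have "z = Complex (Re z) 0" "z + \<i> = Complex (Re z) 1" using True by (auto simp: complex_eq_iff)
          then have "glue Q (s, z + \<i>) (?r, z)" using glue.vertical[OF s, of "Re z"] 2 by auto
          from glued_point_glue[OF this] show ?thesis using a 2 True by simp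
        qed (use a 2 in auto)
      qed (use a in auto)
    qed
    show "torus_class (snd a) \<noteq> torus_class 0" if "a \<in> V" for a
      using that not_Ints_between[of 0 "Re (snd a)"] by (auto simp: V_def torus_class_eq_0_iff)
  qed
  then obtain \<phi> where "translation_chart Q (glued_point Q ` V) \<phi>" ..
  moreover have "glued_point Q (s, Complex y 1) \<in> glued_point Q ` V" if "0 < y" "y < 1" for y
    using that by (intro imageI) (auto simp: V_def in_cbox_complex_iff)
  ultimately show ?thesis by (rule that)
qed

lemma translation_chart_exists:
  assumes Q: "origami Q" and P: "P \<in> punctured_surface Q"
  obtains U \<phi> where "translation_chart Q U \<phi>" "P \<in> U"
proof -
  have right: "bij_betw (right_of Q) (squares Q) (squares Q)"
    and above: "bij_betw (above Q) (squares Q) (squares Q)"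
    using Q by (auto simp: origami_def)
  obtain s z where s: "s \<in> squares Q" and z: "z \<in> cbox 0 (Complex 1 1)"
    and Psz: "P = glued_point Q (s, z)" "covering Q P = torus_class z"
    using surface_point_cases P unfolding punctured_surface_def by blast
  then have "torus_class z \<noteq> torus_class 0"
    using P by (auto simp: punctured_surface_def vertices_def)
  then have nz: "Re z \<notin> {0, 1} \<or> Im z \<notin> {0, 1}" by (auto simp: torus_class_eq_0_iff)
  consider "0 < Re z" "Re z < 1" "0 < Im z" "Im z < 1"
    | "Re z = 1" "0 < Im z" "Im z < 1" | "Re z = 0" "0 < Im z" "Im z < 1"
    | "Im z = 1" "0 < Re z" "Re z < 1" | "Im z = 0" "0 < Re z" "Re z < 1"
    using nz z unfolding in_cbox_complex_iff
    by (cases "Re z = 0"; cases "Re z = 1"; cases "Im z = 0"; cases "Im z = 1") auto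
  then show ?thesis
  proof cases
    case 1
    then have "P \<in> glued_point Q ` ({s} \<times> box 0 (Complex 1 1))"
      unfolding Psz by (intro imageI) (auto simp: in_box_complex_iff)
    then show ?thesis using translation_chart_square[OF s] that by blast
  next
    case 2
    then have "z = Complex 1 (Im z)" by (simp add: complex_eq_iff)
    then have "P = glued_point Q (s, Complex 1 (Im z))" using Psz by metis
    then show ?thesis using translation_chart_vertical_edge[OF right s] 2 that by metis
  next
    case 3
    obtain t where t: "t \<in> squares Q" "s = right_of Q t" using right s by (auto simp: bij_betw_def)
    have "z = Complex 0 (Im z)" using 3 by (simp add: complex_eq_iff)
    then have "P = glued_point Q (t, Complex 1 (Im z))"
      using glued_point_glue[OF glue.horizontal[OF t(1), of "Im z"]] 3 Psz t(2) by simp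
    then show ?thesis using translation_chart_vertical_edge[OF right t(1)] 3 that by metis
  next
    case 4
    then have "z = Complex (Re z) 1" by (simp add: complex_eq_iff)
    then have "P = glued_point Q (s, Complex (Re z) 1)" using Psz by metis
    then show ?thesis using translation_chart_horizontal_edge[OF above s] 4 that by metis
  next
    case 5
    obtain t where t: "t \<in> squares Q" "s = above Q t" using above s by (auto simp: bij_betw_def)
    have "z = Complex (Re z) 0" using 5 by (simp add: complex_eq_iff)
    then have "P = glued_point Q (t, Complex (Re z) 1)"
      using glued_point_glue[OF glue.vertical[OF t(1), of "Re z"]] 5 Psz t(2) by simp
    then show ?thesis using translation_chart_horizontal_edge[OF above t(1)] 5 that by metis
  qed
qed

section \<open>Affine maps act linearly on displacements\<close>

lemma translation_chart_lift:
  assumes chart: "translation_chart Q U \<phi>"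
    and u: "continuous_map (top_of_set J) (surface Q) u" and uU: "u ` J \<subseteq> U"
  shows "torus_lift Q J u (\<phi> \<circ> u)"
proof -
  have "continuous_map (top_of_set J) (subtopology (surface Q) U) u"
    using u by (rule continuous_map_into_subtopology) (use uU in auto)
  moreover have "continuous_map (subtopology (surface Q) U) (top_of_set (\<phi> ` U)) \<phi>"
    using chart by (simp add: translation_chart_def homeomorphic_imp_continuous_map)
  ultimately have "continuous_map (top_of_set J) (top_of_set (\<phi> ` U)) (\<phi> \<circ> u)"
    by (rule continuous_map_compose)
  then have "continuous_on J (\<phi> \<circ> u)" by auto
  moreover have "torus_class ((\<phi> \<circ> u) x) = covering Q (u x)" if "x \<in> J" for x
    using chart uU that by (auto simp: translation_chart_def)
  ultimately show ?thesis by (simp add: torus_lift_def)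
qed

lemma linear_action_diff: "linear_action A (z - w) = linear_action A z - linear_action A w"
  by (simp add: linear_action_def complex_eq_iff algebra_simps)

lemma continuous_on_linear_action:
  "continuous_on S g \<Longrightarrow> continuous_on S (\<lambda>x. linear_action A (g x))"
  unfolding linear_action_def by (intro continuous_intros)

text \<open>Near a parameter that is mapped into \<open>X\<^sup>*\<close>, the lifts of \<open>u\<close> and of \<open>f \<circ> u\<close> differ by constants from
  chart coordinates of these paths, and in charts \<open>f\<close> is \<open>z \<mapsto> A z + b\<close>.\<close>

lemma affine_lift_locally_constant:
  fixes u :: "real \<Rightarrow> ('s \<times> complex) set"
  assumes Q: "origami Q" and f: "continuous_map (surface Q) (surface Q) f"
    and fX: "f ` punctured_surface Q \<subseteq> punctured_surface Q" and aff: "affine_with Q A f"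
    and u: "continuous_map (top_of_set {0..1}) (surface Q) u"
    and L: "torus_lift Q {0..1} u L" and L': "torus_lift Q {0..1} (f \<circ> u) L'"
    and t: "t \<in> {0..1}" "u t \<in> punctured_surface Q"
  obtains \<epsilon> where "\<epsilon> > 0"
    "\<And>t'. t' \<in> {0..1} \<Longrightarrow> \<bar>t' - t\<bar> < \<epsilon> \<Longrightarrow> L' t' - linear_action A (L t') = L' t - linear_action A (L t)"
proof -
  obtain U \<phi> where U: "translation_chart Q U \<phi>" "u t \<in> U"
    using translation_chart_exists[OF Q t(2)] by blast
  have "f (u t) \<in> punctured_surface Q" using fX t(2) by blast
  then obtain V \<psi> where V: "translation_chart Q V \<psi>" "f (u t) \<in> V"
    using translation_chart_exists[OF Q] by blast
  obtain W b where W: "openin (surface Q) W" "u t \<in> W" "W \<subseteq> U" "f ` W \<subseteq> V"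
    and b: "\<And>R. R \<in> W \<Longrightarrow> \<psi> (f R) = linear_action A (\<phi> R) + b"
    using aff U V unfolding affine_with_def by metis
  have "openin (top_of_set {0..1}) {x \<in> {0..1}. u x \<in> W}"
    using openin_continuous_map_preimage[OF u W(1)] by simp
  then obtain \<epsilon> where \<epsilon>: "\<epsilon> > 0" "{0..1} \<inter> ball t \<epsilon> \<subseteq> {x \<in> {0..1}. u x \<in> W}"
    using t(1) W(2) unfolding openin_contains_ball by blast
  let ?J = "{0..1} \<inter> ball t \<epsilon>"
  have J: "connected ?J" by (intro convex_connected convex_Int) auto
  have uJ: "continuous_map (top_of_set ?J) (surface Q) u"
    using continuous_map_from_subtopology_mono[OF u] by blast
  have LJ: "torus_lift Q ?J u L" "torus_lift Q ?J (f \<circ> u) L'"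
    using L L' unfolding torus_lift_def by (auto intro: continuous_on_subset)
  have 1: "torus_lift Q ?J u (\<phi> \<circ> u)"
    by (rule translation_chart_lift[OF U(1) uJ]) (use \<epsilon>(2) W(3) in auto)
  have 2: "torus_lift Q ?J (f \<circ> u) (\<psi> \<circ> (f \<circ> u))"
    by (rule translation_chart_lift[OF V(1) continuous_map_compose[OF uJ f]]) (use \<epsilon>(2) W(4) in auto)
  show ?thesis
  proof (rule that[OF \<epsilon>(1)])
    fix t' assume t': "t' \<in> {0..1}" "\<bar>t' - t\<bar> < \<epsilon>"
    have tt': "t \<in> ?J" "t' \<in> ?J" using t t' \<epsilon>(1) by (auto simp: dist_real_def)
    have "u t' \<in> W" "u t \<in> W" using \<epsilon>(2) tt' by auto
    then have "\<psi> (f (u t')) - \<psi> (f (u t)) = linear_action A (\<phi> (u t') - \<phi> (u t))"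
      using b by (simp add: linear_action_diff)
    moreover have "\<phi> (u t') - \<phi> (u t) = L t' - L t"
      using torus_lift_unique[OF J LJ(1) 1 tt'] by (simp add: algebra_simps)
    moreover have "\<psi> (f (u t')) - \<psi> (f (u t)) = L' t' - L' t"
      using torus_lift_unique[OF J LJ(2) 2 tt'] by (simp add: algebra_simps)
    ultimately show "L' t' - linear_action A (L t') = L' t - linear_action A (L t)"
      by (simp add: linear_action_diff algebra_simps)
  qed
qed

text \<open>Let \<open>D = L' - A L\<close>. Over \<open>X\<^sup>*\<close> it is locally constant, so each of its values there is
  already attained at a rational parameter. Over a vertex both lifts take values in the lattice,
  since \<open>f\<close> permutes the vertices. So \<open>D\<close> has a countable image and is constant, however wildly the path
  meets the vertices.\<close>

lemma affine_lift_difference: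
  fixes u :: "real \<Rightarrow> ('s \<times> complex) set"
  assumes Q: "origami Q" and f: "homeomorphic_map (surface Q) (surface Q) f"
    and fX: "f ` punctured_surface Q = punctured_surface Q" and aff: "affine_with Q A f"
    and u: "continuous_map (top_of_set {0..1}) (surface Q) u"
    and L: "torus_lift Q {0..1} u L" and L': "torus_lift Q {0..1} (f \<circ> u) L'"
  shows "L' 1 - L' 0 = linear_action A (L 1 - L 0)"
proof -
  define D where "D t = L' t - linear_action A (L t)" for t
  have contf: "continuous_map (surface Q) (surface Q) f"
    using f by (rule homeomorphic_imp_continuous_map)
  let ?\<Lambda> = "{z. Re z \<in> \<int> \<and> Im z \<in> \<int>}"
  have "D ` {0..1} \<subseteq> D ` (\<rat> \<inter> {0..1}) \<union> (\<lambda>(a, b). a - linear_action A b) ` (?\<Lambda> \<times> ?\<Lambda>)"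
  proof (intro image_subsetI)
    fix t :: real assume t: "t \<in> {0..1}"
    have ut: "u t \<in> topspace (surface Q)" using u t by (auto simp: continuous_map_def)
    show "D t \<in> D ` (\<rat> \<inter> {0..1}) \<union> (\<lambda>(a, b). a - linear_action A b) ` (?\<Lambda> \<times> ?\<Lambda>)"
    proof (cases "u t \<in> punctured_surface Q")
      case True
      obtain \<epsilon> where \<epsilon>: "\<epsilon> > 0" "\<And>t'. t' \<in> {0..1} \<Longrightarrow> \<bar>t' - t\<bar> < \<epsilon> \<Longrightarrow> D t' = D t"
        using affine_lift_locally_constant[OF Q contf _ aff u L L' t True] fX
        unfolding D_def by blast
      have "max 0 (t - \<epsilon>) < min 1 (t + \<epsilon>)" using \<epsilon>(1) t by auto
      then obtain q where "q \<in> \<rat>" "max 0 (t - \<epsilon>) < q" "q < min 1 (t + \<epsilon>)"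
        using Rats_dense_in_real by blast
      then have "q \<in> \<rat> \<inter> {0..1}" "D q = D t" using \<epsilon>(2)[of q] by auto
      then have "D t \<in> D ` (\<rat> \<inter> {0..1})" by (intro image_eqI[of _ _ q]) simp_all
      then show ?thesis by (rule UnI1)
    next
      case False
      have "f (u t) \<notin> punctured_surface Q"
      proof
        assume "f (u t) \<in> punctured_surface Q"
        then obtain R where R: "R \<in> punctured_surface Q" "f R = f (u t)" using fX by (metis imageE)
        moreover have "inj_on f (topspace (surface Q))"
          using f by (rule homeomorphic_imp_injective_map)
        ultimately show False
          using False ut by (auto simp: punctured_surface_def inj_on_def)
      qed
      moreover have "f (u t) \<in> topspace (surface Q)"
        using contf ut by (auto simp: continuous_map_def)
      ultimately have "torus_class (L t) = torus_class 0" "torus_class (L' t) = torus_class 0"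
        using False ut L L' t by (auto simp: punctured_surface_def vertices_def torus_lift_def)
      then show ?thesis
        by (intro UnI2 image_eqI[of _ _ "(L' t, L t)"]) (auto simp: D_def torus_class_eq_0_iff)
    qed
  qed
  moreover have "countable (D ` (\<rat> \<inter> {0..1}) \<union> (\<lambda>(a, b). a - linear_action A b) ` (?\<Lambda> \<times> ?\<Lambda>))"
    by (intro countable_Un countable_image countable_SIGMA countable_lattice countable_Int1 countable_rat)
  ultimately have "countable (D ` {0..1})" by (rule countable_subset)
  moreover have "continuous_on {0..1} D"
    unfolding D_def using L L' unfolding torus_lift_def
    by (intro continuous_on_diff continuous_on_linear_action) auto
  ultimately have "D 1 = D 0"
    by (intro constant_if_countable_image[of "{0..1}" D]) auto
  then show ?thesis by (simp add: D_def linear_action_diff algebra_simps)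
qed

text \<open>In charts around one point of \<open>X\<^sup>*\<close> and its image, two admissible linear parts agree on a small
  circle up to a translation, hence they are equal; so \<^const>\<open>der\<close> is well defined.\<close>

lemma der_eq:
  assumes Q: "origami Q" and f: "homeomorphic_map (surface Q) (surface Q) f"
    and fX: "f ` punctured_surface Q = punctured_surface Q"
    and A: "A \<in> SL2R" "affine_with Q A f"
  shows "der Q f = A"
  unfolding der_def
proof (rule the_equality)
  fix B assume B: "B \<in> SL2R \<and> affine_with Q B f"
  obtain s where s: "s \<in> squares Q" using Q by (auto simp: origami_def)
  let ?P = "glued_point Q (s, Complex (1/2) (1/2))"
  have "covering Q ?P \<noteq> torus_class 0"
    using not_Ints_between[of 0 "1/2"] by (simp add: covering_glued_point torus_class_eq_0_iff)
  moreover have "?P \<in> topspace (surface Q)"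
    unfolding topspace_surface using s by (intro imageI) (auto simp: in_cbox_complex_iff)
  ultimately have P: "?P \<in> punctured_surface Q" by (simp add: punctured_surface_def vertices_def)
  obtain U \<phi> where U: "translation_chart Q U \<phi>" "?P \<in> U" using translation_chart_exists[OF Q P] by blast
  obtain V \<psi> where V: "translation_chart Q V \<psi>" "f ?P \<in> V"
    using translation_chart_exists[OF Q, of "f ?P"] P fX by blast
  obtain W a where W: "openin (surface Q) W" "?P \<in> W" "W \<subseteq> U"
    and a: "\<And>R. R \<in> W \<Longrightarrow> \<psi> (f R) = linear_action A (\<phi> R) + a"
    using A(2) U V unfolding affine_with_def by metis
  obtain W' b where W': "openin (surface Q) W'" "?P \<in> W'" "W' \<subseteq> U"
    and b: "\<And>R. R \<in> W' \<Longrightarrow> \<psi> (f R) = linear_action B (\<phi> R) + b"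
    using B U V unfolding affine_with_def by metis
  have "openin (subtopology (surface Q) U) (W \<inter> W')"
    using W W' by (auto intro!: subtopology_restrict openin_subtopology_Int2 simp: openin_subtopology)
  then have "openin (top_of_set (\<phi> ` U)) (\<phi> ` (W \<inter> W'))"
    using U(1) homeomorphic_imp_open_map unfolding translation_chart_def open_map_def by blast
  then have "open (\<phi> ` (W \<inter> W'))"
    using U(1) openin_open_trans unfolding translation_chart_def by blast
  moreover have "\<phi> ?P \<in> \<phi> ` (W \<inter> W')" using W W' by blast
  ultimately obtain \<epsilon> where \<epsilon>: "\<epsilon> > 0" "cball (\<phi> ?P) \<epsilon> \<subseteq> \<phi> ` (W \<inter> W')"
    using open_contains_cball by metis
  have eq: "linear_action A w + a = linear_action B w + b" if w: "w \<in> cball (\<phi> ?P) \<epsilon>" for w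
  proof -
    obtain R where "R \<in> W \<inter> W'" "w = \<phi> R" using \<epsilon>(2) w by blast
    then show ?thesis using a[of R] b[of R] by auto
  qed
  have "linear_action A v = linear_action B v" if "norm v = \<epsilon>" for v
  proof -
    have "linear_action A (\<phi> ?P + v) + a = linear_action B (\<phi> ?P + v) + b"
      by (rule eq) (use that in \<open>simp add: dist_norm\<close>)
    moreover have "linear_action A (\<phi> ?P) + a = linear_action B (\<phi> ?P) + b"
      by (rule eq) (use \<epsilon>(1) in simp)
    ultimately have "linear_action A (\<phi> ?P + v - \<phi> ?P) = linear_action B (\<phi> ?P + v - \<phi> ?P)"
      unfolding linear_action_diff by (metis add_diff_cancel_right)
    then show ?thesis by simp
  qed
  from this[of "Complex \<epsilon> 0"] this[of "Complex 0 \<epsilon>"] \<epsilon>(1)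
  have "A $$ (0,0) = B $$ (0,0)" "A $$ (1,0) = B $$ (1,0)" "A $$ (0,1) = B $$ (0,1)" "A $$ (1,1) = B $$ (1,1)"
    by (auto simp: linear_action_def cmod_def)
  then show "B = A"
    using A(1) B unfolding SL2R_def by (intro eq_matI) (auto simp: less_2_cases_iff)
qed (use A in blast)

section \<open>The holonomy homomorphism on homology\<close>

text \<open>Standard simplices consist of functions \<open>nat \<Rightarrow> real\<close>, which do not form a normed space. Affine
  parametrizations of the \<open>1\<close>- and \<open>2\<close>-simplex by convex subsets of normed spaces make the lifting
  results applicable.\<close>

definition segment_point :: "real \<Rightarrow> nat \<Rightarrow> real" where
  "segment_point t = (\<lambda>i. if i = 0 then 1 - t else if i = 1 then t else 0)"

definition triangle_point :: "real \<times> real \<Rightarrow> nat \<Rightarrow> real" where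
  "triangle_point = (\<lambda>(x, y) i. if i = 0 then 1 - x - y else if i = 1 then x else if i = 2 then y else 0)"

definition triangle :: "(real \<times> real) set" where
  "triangle = {(x, y). 0 \<le> x \<and> 0 \<le> y \<and> x + y \<le> 1}"

lemma segment_point_in_standard_simplex:
  "t \<in> {0..1} \<Longrightarrow> segment_point t \<in> standard_simplex 1"
  by (auto simp: segment_point_def standard_simplex_def)

lemma triangle_point_in_standard_simplex:
  "p \<in> triangle \<Longrightarrow> triangle_point p \<in> standard_simplex 2"
  by (auto simp: triangle_def triangle_point_def standard_simplex_def numeral_2_eq_2)

lemma continuous_map_segment_point:
  "continuous_map (top_of_set {0..1}) (subtopology (powertop_real UNIV) (standard_simplex 1)) segment_point"
proof (rule continuous_map_into_subtopology)
  show "continuous_map (top_of_set {0..1}) (powertop_real UNIV) segment_point"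
    unfolding continuous_map_componentwise_UNIV
  proof
    fix i show "continuous_map (top_of_set {0..1}) euclideanreal (\<lambda>t. segment_point t i)"
      by (cases "i = 0"; cases "i = 1") (auto simp: segment_point_def intro!: continuous_intros)
  qed
qed (use segment_point_in_standard_simplex in auto)

lemma continuous_map_triangle_point:
  "continuous_map (top_of_set triangle) (subtopology (powertop_real UNIV) (standard_simplex 2)) triangle_point"
proof (rule continuous_map_into_subtopology)
  show "continuous_map (top_of_set triangle) (powertop_real UNIV) triangle_point"
    unfolding continuous_map_componentwise_UNIV
  proof
    fix i show "continuous_map (top_of_set triangle) euclideanreal (\<lambda>t. triangle_point t i)"
      by (cases "i = 0"; cases "i = 1"; cases "i = 2")
        (auto simp: triangle_point_def case_prod_unfold intro!: continuous_intros)
  qed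
qed (use triangle_point_in_standard_simplex in auto)

lemma convex_triangle: "convex triangle"
proof -
  have "triangle = {p. inner (1, 0) p \<ge> 0} \<inter> ({p. inner (0, 1) p \<ge> 0} \<inter> {p. inner (1, 1) p \<le> 1})"
    by (auto simp: triangle_def inner_prod_def)
  then show ?thesis
    by (metis convex_Int convex_halfspace_ge convex_halfspace_le)
qed

text \<open>The integral of the \<open>1\<close>-form \<open>dz\<close> of the translation structure along \<open>\<sigma>\<close>, read off as the displacement
  of a lift.\<close>

definition simplex_holonomy ::
  "'s origami_data \<Rightarrow> ((nat \<Rightarrow> real) \<Rightarrow> ('s \<times> complex) set) \<Rightarrow> complex" where
  "simplex_holonomy Q \<sigma> =
     (THE d. \<exists>L. torus_lift Q {0..1} (\<sigma> \<circ> segment_point) L \<and> d = L 1 - L 0)"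

lemma simplex_holonomy_eq:
  assumes "torus_lift Q {0..1} (\<sigma> \<circ> segment_point) L"
  shows "simplex_holonomy Q \<sigma> = L 1 - L 0"
  unfolding simplex_holonomy_def
proof (rule the_equality)
  fix d assume "\<exists>L. torus_lift Q {0..1} (\<sigma> \<circ> segment_point) L \<and> d = L 1 - L 0"
  then obtain L' where L': "torus_lift Q {0..1} (\<sigma> \<circ> segment_point) L'" "d = L' 1 - L' 0" by blast
  have "L' 1 - L 1 = L' 0 - L 0"
    by (rule torus_lift_unique[OF _ assms L'(1)]) auto
  then show "d = L 1 - L 0" using L'(2) by (metis diff_diff_eq2 add_diff_eq diff_add_eq eq_diff_eq add.commute)
qed (use assms in blast)

definition holonomy :: "'s origami_data \<Rightarrow> ('s \<times> complex) set chain \<Rightarrow> complex" where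
  "holonomy Q c = (\<Sum>\<sigma>\<in>Poly_Mapping.keys c. of_int (poly_mapping.lookup c \<sigma>) * simplex_holonomy Q \<sigma>)"

lemma holonomy_superset:
  assumes "finite S" "Poly_Mapping.keys c \<subseteq> S"
  shows "holonomy Q c = (\<Sum>\<sigma>\<in>S. of_int (poly_mapping.lookup c \<sigma>) * simplex_holonomy Q \<sigma>)"
  unfolding holonomy_def
  by (rule sum.mono_neutral_left) (use assms in \<open>auto simp: in_keys_iff\<close>)

lemma holonomy_0 [simp]: "holonomy Q 0 = 0"
  by (simp add: holonomy_def)

lemma holonomy_of [simp]: "holonomy Q (frag_of \<sigma>) = simplex_holonomy Q \<sigma>"
  by (simp add: holonomy_def)

lemma holonomy_add: "holonomy Q (c + d) = holonomy Q c + holonomy Q d"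
proof -
  let ?S = "Poly_Mapping.keys c \<union> Poly_Mapping.keys d"
  have "Poly_Mapping.keys (c + d) \<subseteq> ?S" by (rule keys_add)
  then show ?thesis
    by (simp add: holonomy_superset[of ?S] lookup_add distrib_right sum.distrib)
qed

lemma holonomy_minus: "holonomy Q (- c) = - holonomy Q c"
  using holonomy_add[of Q c "- c"] by (simp add: eq_neg_iff_add_eq_0 add.commute)

lemma holonomy_diff: "holonomy Q (c - d) = holonomy Q c - holonomy Q d"
  using holonomy_add[of Q c "- d"] by (simp add: holonomy_minus)

lemma holonomy_sum: "holonomy Q (\<Sum>i\<in>I. c i) = (\<Sum>i\<in>I. holonomy Q (c i))"
  by (induction I rule: infinite_finite_induct) (auto simp: holonomy_add)

lemma singular_simplex_segment:
  assumes "singular_simplex 1 X \<sigma>"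
  shows "continuous_map (top_of_set {0..1}) X (\<sigma> \<circ> segment_point)"
  using assms unfolding singular_simplex_def
  by (blast intro: continuous_map_compose[OF continuous_map_segment_point])

text \<open>The form \<open>dz\<close> is closed: a lift of the whole \<open>2\<close>-simplex restricts to lifts of its three faces, whose
  displacements are differences of the values at the corners and cancel.\<close>

lemma holonomy_boundary_simplex:
  assumes "singular_simplex 2 (surface Q) \<tau>"
  shows "holonomy Q (chain_boundary 2 (frag_of \<tau>)) = 0"
proof -
  have "continuous_map (top_of_set triangle) (surface Q) (\<tau> \<circ> triangle_point)"
    using assms unfolding singular_simplex_def
    by (blast intro: continuous_map_compose[OF continuous_map_triangle_point])
  then obtain L where L: "torus_lift Q triangle (\<tau> \<circ> triangle_point) L"
    using torus_lift_exists[OF convex_triangle] by blast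
  have face: "simplex_holonomy Q (singular_face 2 k \<tau>) = L (e 1) - L (e 0)"
    if e: "continuous_on {0..1} e" "e ` {0..1} \<subseteq> triangle"
      "\<And>t. t \<in> {0..1} \<Longrightarrow> simplical_face k (segment_point t) = triangle_point (e t)"
    for k and e :: "real \<Rightarrow> real \<times> real"
  proof -
    have "torus_lift Q {0..1} (singular_face 2 k \<tau> \<circ> segment_point) (L \<circ> e)"
      unfolding torus_lift_def
    proof
      show "continuous_on {0..1} (L \<circ> e)"
        using L e(1,2) unfolding torus_lift_def
        by (intro continuous_on_compose) (auto intro: continuous_on_subset)
      show "\<forall>t\<in>{0..1}. torus_class ((L \<circ> e) t) = covering Q ((singular_face 2 k \<tau> \<circ> segment_point) t)"
        using L e(2) segment_point_in_standard_simplex e(3)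
        unfolding torus_lift_def by (auto simp: singular_face_def)
    qed
    then show ?thesis by (simp add: simplex_holonomy_eq)
  qed
  have "simplex_holonomy Q (singular_face 2 0 \<tau>) = L (0, 1) - L (1, 0)"
    by (rule trans[OF face[where e = "\<lambda>t. (1 - t, t)"]])
      (auto simp: triangle_def simplical_face_def segment_point_def triangle_point_def fun_eq_iff
        intro!: continuous_intros)
  moreover have "simplex_holonomy Q (singular_face 2 1 \<tau>) = L (0, 1) - L (0, 0)"
    by (rule trans[OF face[where e = "\<lambda>t. (0, t)"]])
      (auto simp: triangle_def simplical_face_def segment_point_def triangle_point_def fun_eq_iff
        intro!: continuous_intros)
  moreover have "simplex_holonomy Q (singular_face 2 2 \<tau>) = L (1, 0) - L (0, 0)"
    by (rule trans[OF face[where e = "\<lambda>t. (t, 0)"]])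
      (auto simp: triangle_def simplical_face_def segment_point_def triangle_point_def fun_eq_iff
        intro!: continuous_intros)
  ultimately show ?thesis
    by (simp add: chain_boundary_of numeral_2_eq_2 holonomy_add holonomy_minus holonomy_diff)
qed

lemma holonomy_boundary:
  assumes "singular_relboundary 1 (surface Q) {} c"
  shows "holonomy Q c = 0"
proof -
  obtain d where d: "singular_chain 2 (surface Q) d" "chain_boundary 2 d = c"
    using assms unfolding singular_boundary by (auto simp: numeral_2_eq_2)
  have "holonomy Q (chain_boundary 2 d) = 0"
    using d(1) unfolding singular_chain_def
  proof (induction d rule: frag_induction)
    case (diff a b)
    then show ?case by (simp add: chain_boundary_diff holonomy_diff)
  qed (auto simp: holonomy_boundary_simplex)
  then show ?thesis using d(2) by simp
qed

text \<open>The equation holds for all chains, not only for cycles, because \<open>affine_lift_difference\<close> applies to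
  every single path.\<close>

lemma holonomy_chain_map:
  assumes Q: "origami Q" and f: "homeomorphic_map (surface Q) (surface Q) f"
    and fX: "f ` punctured_surface Q = punctured_surface Q" and aff: "affine_with Q A f"
    and c: "singular_chain 1 (surface Q) c"
  shows "holonomy Q (chain_map 1 f c) = linear_action A (holonomy Q c)"
  using c unfolding singular_chain_def
proof (induction c rule: frag_induction)
  case zero
  show ?case by (simp add: linear_action_def complex_eq_iff)
next
  case (one \<sigma>)
  let ?u = "\<sigma> \<circ> segment_point"
  have u: "continuous_map (top_of_set {0..1}) (surface Q) ?u"
    using one by (intro singular_simplex_segment) simp
  have fu: "continuous_map (top_of_set {0..1}) (surface Q) (f \<circ> ?u)"
    using continuous_map_compose[OF u homeomorphic_imp_continuous_map[OF f]] .
  obtain L where L: "torus_lift Q {0..1} ?u L"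
    using torus_lift_exists[OF _ u] convex_real_interval by blast
  obtain L' where L': "torus_lift Q {0..1} (f \<circ> ?u) L'"
    using torus_lift_exists[OF _ fu] convex_real_interval by blast
  have "torus_lift Q {0..1} (simplex_map 1 f \<sigma> \<circ> segment_point) L'"
    using L' segment_point_in_standard_simplex unfolding torus_lift_def simplex_map_def by auto
  then have "simplex_holonomy Q (simplex_map 1 f \<sigma>) = L' 1 - L' 0" by (rule simplex_holonomy_eq)
  also have "\<dots> = linear_action A (L 1 - L 0)"
    by (rule affine_lift_difference[OF Q f fX aff u L L'])
  also have "L 1 - L 0 = simplex_holonomy Q \<sigma>" using simplex_holonomy_eq[OF L] by simp
  finally show ?case by simp
next
  case (diff a b)
  then show ?case by (simp add: chain_map_diff holonomy_diff linear_action_diff)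
qed

text \<open>Homology classes are cosets of the boundaries, and \<open>holonomy_boundary\<close> makes the choice of an element
  irrelevant.\<close>

definition class_holonomy :: "'s origami_data \<Rightarrow> ('s \<times> complex) set chain set \<Rightarrow> complex" where
  "class_holonomy Q x = holonomy Q (SOME c. c \<in> x)"

lemma carrier_homology_group_1:
  "carrier (homology_group 1 X) = homologous_rel_set 1 X {} ` singular_relcycle_set 1 X {}"
  using carrier_relative_homology_group[of 1 X "{}"] by simp

lemma class_holonomy_eq:
  assumes x: "x \<in> carrier (homology_group 1 (surface Q))" and c: "c \<in> x"
  shows "class_holonomy Q x = holonomy Q c"
proof -
  obtain a where a: "x = homologous_rel_set 1 (surface Q) {} a"
    using x unfolding carrier_homology_group_1 by blast
  have "(SOME c. c \<in> x) \<in> x" using c by (rule someI)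
  then have "homologous_rel 1 (surface Q) {} (SOME c. c \<in> x) c"
    using c unfolding a by (metis homologous_rel_sym homologous_rel_trans mem_Collect_eq)
  then have "holonomy Q ((SOME c. c \<in> x) - c) = 0"
    unfolding homologous_rel_def by (rule holonomy_boundary)
  then show ?thesis by (simp add: class_holonomy_def holonomy_diff)
qed

lemma class_holonomy_rel_set:
  assumes "singular_relcycle 1 (surface Q) {} c"
  shows "class_holonomy Q (homologous_rel_set 1 (surface Q) {} c) = holonomy Q c"
  by (rule class_holonomy_eq) (use assms in \<open>auto simp: carrier_homology_group_1\<close>)

lemma class_holonomy_mult:
  assumes "x \<in> carrier (homology_group 1 (surface Q))" "y \<in> carrier (homology_group 1 (surface Q))"
  shows "class_holonomy Q (x \<otimes>\<^bsub>homology_group 1 (surface Q)\<^esub> y) = class_holonomy Q x + class_holonomy Q y"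
proof -
  have "z \<noteq> {}" if "z \<in> carrier (homology_group 1 (surface Q))" for z
    using that homologous_rel_refl unfolding carrier_homology_group_1 by blast
  then obtain a b where ab: "a \<in> x" "b \<in> y" using assms by blast
  interpret group "homology_group 1 (surface Q)" by simp
  have "a + b \<in> x \<otimes>\<^bsub>homology_group 1 (surface Q)\<^esub> y"
    using ab mult_relative_homology_group[of 1 "surface Q" "{}"] by auto
  then have "class_holonomy Q (x \<otimes>\<^bsub>homology_group 1 (surface Q)\<^esub> y) = holonomy Q (a + b)"
    using assms by (intro class_holonomy_eq) auto
  then show ?thesis using assms ab by (simp add: class_holonomy_eq holonomy_add)
qed

lemma class_holonomy_hom_induced:
  assumes Q: "origami Q" and f: "homeomorphic_map (surface Q) (surface Q) f"
    and fX: "f ` punctured_surface Q = punctured_surface Q" and aff: "affine_with Q A f"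
    and x: "x \<in> carrier (homology_group 1 (surface Q))"
  shows "class_holonomy Q (hom_induced 1 (surface Q) {} (surface Q) {} f x) =
    linear_action A (class_holonomy Q x)"
proof -
  obtain c where c: "singular_relcycle 1 (surface Q) {} c" "x = homologous_rel_set 1 (surface Q) {} c"
    using x unfolding carrier_homology_group_1 by blast
  have contf: "continuous_map (surface Q) (surface Q) f"
    using f by (rule homeomorphic_imp_continuous_map)
  have "hom_induced 1 (surface Q) {} (surface Q) {} f x =
      homologous_rel_set 1 (surface Q) {} (chain_map 1 f c)"
    using hom_induced_chain_map[OF contf _ c(1)] c(2) by simp
  moreover have "singular_relcycle 1 (surface Q) {} (chain_map 1 f c)"
    by (rule singular_relcycle_chain_map[OF c(1) contf]) simp
  moreover have "singular_chain 1 (surface Q) c" using c(1) by (simp add: singular_relcycle_def)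
  ultimately show ?thesis
    using holonomy_chain_map[OF Q f fX aff] c by (metis class_holonomy_rel_set)
qed

text \<open>The cycle is the sum of one segment in direction \<open>\<delta>\<close> across each square: the
  gluing \<open>r\<close> permutes the squares, so the end points and the starting points of all these segments
  cancel without following single orbits of \<open>r\<close>.\<close>

lemma crossing_cycle:
  fixes z0 \<delta> :: complex
  assumes Q: "origami Q" and r: "bij_betw r (squares Q) (squares Q)"
    and z0: "\<And>t. t \<in> {0..1} \<Longrightarrow> z0 + of_real t * \<delta> \<in> cbox 0 (Complex 1 1)"
    and glue: "\<And>s. s \<in> squares Q \<Longrightarrow> glued_point Q (s, z0 + \<delta>) = glued_point Q (r s, z0)"
  obtains x where "x \<in> carrier (homology_group 1 (surface Q))"
    "class_holonomy Q x = of_nat (card (squares Q)) * \<delta>"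
proof -
  define \<sigma> where "\<sigma> s = (\<lambda>p\<in>standard_simplex 1. glued_point Q (s, z0 + of_real (p 1) * \<delta>))" for s
  define v where "v s = (\<lambda>p\<in>standard_simplex 0. glued_point Q (s, z0))" for s
  define c where "c = (\<Sum>s\<in>squares Q. frag_of (\<sigma> s))"
  have simplex: "singular_simplex 1 (surface Q) (\<sigma> s)" if s: "s \<in> squares Q" for s
  proof -
    let ?X = "subtopology (powertop_real UNIV) (standard_simplex 1)"
    have "continuous_map (powertop_real UNIV) euclideanreal (\<lambda>p. p 1)"
      by (rule continuous_map_product_projection) simp
    then have "continuous_map ?X euclideanreal (\<lambda>p. p 1)" by (rule continuous_map_from_subtopology)
    then have "continuous_map ?X (top_of_set {0..1}) (\<lambda>p. p 1)"
      by (rule continuous_map_into_subtopology) (auto simp: standard_simplex_def)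
    moreover have "continuous_map (top_of_set {0..1}) (surface Q) (\<lambda>t. glued_point Q (s, z0 + of_real t * \<delta>))"
      by (rule continuous_map_into_square[OF s]) (use z0 in \<open>auto intro!: continuous_intros\<close>)
    ultimately have "continuous_map ?X (surface Q) ((\<lambda>t. glued_point Q (s, z0 + of_real t * \<delta>)) \<circ> (\<lambda>p. p 1))"
      by (rule continuous_map_compose)
    then have "continuous_map ?X (surface Q) (\<sigma> s)"
      by (rule continuous_map_eq) (simp add: \<sigma>_def)
    then show ?thesis by (simp add: singular_simplex_def \<sigma>_def)
  qed
  have hol: "simplex_holonomy Q (\<sigma> s) = \<delta>" for s
  proof -
    have "torus_lift Q {0..1} (\<sigma> s \<circ> segment_point) (\<lambda>t. z0 + of_real t * \<delta>)"
      unfolding torus_lift_def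
    proof
      show "continuous_on {0..1} (\<lambda>t. z0 + of_real t * \<delta>)" by (intro continuous_intros)
      show "\<forall>t\<in>{0..1}. torus_class (z0 + of_real t * \<delta>) = covering Q ((\<sigma> s \<circ> segment_point) t)"
        using segment_point_in_standard_simplex
        by (auto simp: \<sigma>_def covering_glued_point segment_point_def)
    qed
    from simplex_holonomy_eq[OF this] show ?thesis by simp
  qed
  have "singular_face 1 0 (\<sigma> s) = v (r s)" if "s \<in> squares Q" for s
    using glue[OF that]
    by (auto simp: singular_face_def v_def \<sigma>_def standard_simplex_0 simplical_face_def fun_eq_iff
        restrict_def standard_simplex_def)
  moreover have "singular_face 1 1 (\<sigma> s) = v s" for s
    by (auto simp: singular_face_def v_def \<sigma>_def standard_simplex_0 simplical_face_def fun_eq_iff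
        restrict_def standard_simplex_def)
  ultimately have bd: "chain_boundary 1 (frag_of (\<sigma> s)) = frag_of (v (r s)) - frag_of (v s)"
    if "s \<in> squares Q" for s
    using that by (simp add: chain_boundary_of)
  have "chain_boundary 1 c = (\<Sum>s\<in>squares Q. chain_boundary 1 (frag_of (\<sigma> s)))"
    by (simp add: c_def chain_boundary_sum o_def)
  also have "\<dots> = (\<Sum>s\<in>squares Q. frag_of (v (r s)) - frag_of (v s))"
    by (rule sum.cong) (simp_all only: bd)
  also have "\<dots> = (\<Sum>s\<in>squares Q. frag_of (v (r s))) - (\<Sum>s\<in>squares Q. frag_of (v s))"
    by (rule sum_subtractf)
  also have "\<dots> = 0"
    using sum.reindex_bij_betw[OF r, of "\<lambda>s. frag_of (v s)"] by simp
  finally have "chain_boundary 1 c = 0" .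
  moreover have "singular_chain 1 (surface Q) c"
    unfolding c_def using simplex by (intro singular_chain_sum) (simp add: singular_chain_of)
  ultimately have c: "singular_relcycle 1 (surface Q) {} c" by (simp add: singular_cycle)
  moreover have "holonomy Q c = of_nat (card (squares Q)) * \<delta>"
    by (simp add: c_def holonomy_sum hol)
  ultimately have "class_holonomy Q (homologous_rel_set 1 (surface Q) {} c) = of_nat (card (squares Q)) * \<delta>"
    using class_holonomy_rel_set by metis
  moreover have "homologous_rel_set 1 (surface Q) {} c \<in> carrier (homology_group 1 (surface Q))"
    unfolding carrier_homology_group_1 using c by blast
  ultimately show ?thesis by (intro that)
qed

section \<open>Left eigenvectors from holonomy\<close>

lemma additive_lin_comb:
  fixes h :: "'g \<Rightarrow> complex" and G (structure)
  assumes G: "comm_group G"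
    and h: "\<And>x y. x \<in> carrier G \<Longrightarrow> y \<in> carrier G \<Longrightarrow> h (x \<otimes> y) = h x + h y"
    and c: "\<And>i. i < n \<Longrightarrow> c i \<in> carrier G"
  shows "h (lin_comb G n c k) = (\<Sum>i<n. of_int (k i) * h (c i))"
proof -
  interpret comm_group G by (rule G)
  have h1: "h \<one> = 0" using h[of \<one> \<one>] by simp
  have hinv: "h (inv x) = - h x" if "x \<in> carrier G" for x
    using h[of "inv x" x] that h1 by (simp add: eq_neg_iff_add_eq_0)
  have hnat: "h (x [^] m) = of_nat m * h x" if "x \<in> carrier G" for x and m :: nat
    by (induction m) (use that h h1 in \<open>auto simp: algebra_simps\<close>)
  have hint: "h (x [^] m) = of_int m * h x" if x: "x \<in> carrier G" for x and m :: int
  proof (cases "m \<ge> 0")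
    case True
    then obtain j where "m = int j" using nonneg_int_cases by blast
    then show ?thesis using hnat[OF x, of j] by (simp add: int_pow_int)
  next
    case False
    then obtain j where "m = - int j" by (metis int_cases2 of_nat_0_le_iff)
    then show ?thesis using hnat[OF x, of j] hinv x by (simp add: int_pow_neg int_pow_int)
  qed
  have "m \<le> n \<Longrightarrow> h (finprod G (\<lambda>i. c i [^] k i) {..<m}) = (\<Sum>i<m. of_int (k i) * h (c i))" for m
  proof (induction m)
    case (Suc m)
    have "finprod G (\<lambda>i. c i [^] k i) {..<Suc m} = c m [^] k m \<otimes> finprod G (\<lambda>i. c i [^] k i) {..<m}"
      using c Suc.prems unfolding lessThan_Suc by (subst finprod_insert) auto
    moreover have "finprod G (\<lambda>i. c i [^] k i) {..<m} \<in> carrier G"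
      using c Suc.prems by (intro finprod_closed) auto
    ultimately show ?case using Suc c[of m] hint[of "c m" "k m"] by (simp add: h)
  qed (simp add: h1)
  then show ?thesis by (simp add: lin_comb_def)
qed

lemma lin_comb_Z_coords:
  assumes "Z_basis G n c" "x \<in> carrier G"
  shows "x = lin_comb G n c (Z_coords G n c x)"
proof -
  have "\<exists>!k. k \<in> {..<n} \<rightarrow>\<^sub>E UNIV \<and> x = lin_comb G n c k"
    using assms by (simp add: Z_basis_def)
  from theI'[OF this] show ?thesis by (simp add: Z_coords_def)
qed

lemma det_2:
  fixes A :: "real mat"
  assumes A: "A \<in> carrier_mat 2 2"
  shows "Determinant.det A = A $$ (0,0) * A $$ (1,1) - A $$ (0,1) * A $$ (1,0)"
proof -
  have "mat_delete A 0 j \<in> carrier_mat 1 1" for j using mat_delete_carrier[of A 2 2 0 j] A by simp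
  then have "Determinant.det (mat_delete A 0 j) = mat_delete A 0 j $$ (0,0)" for j
    by (rule det_single)
  moreover have "Determinant.det A = (\<Sum>j<2. A $$ (0, j) * cofactor A 0 j)"
    by (rule laplace_expansion_row[OF A]) simp
  ultimately show ?thesis
    using A by (simp add: cofactor_def mat_delete_def numeral_2_eq_2)
qed

lemma eigenvalue_2_iff:
  fixes A :: "real mat"
  assumes A: "A \<in> carrier_mat 2 2"
  shows "eigenvalue A \<mu> \<longleftrightarrow>
    (A $$ (0,0) - \<mu>) * (A $$ (1,1) - \<mu>) - A $$ (0,1) * A $$ (1,0) = 0"
proof -
  have "char_matrix A \<mu> \<in> carrier_mat 2 2" using A by simp
  then show ?thesis
    unfolding eigenvalue_det[OF A] using A by (simp add: det_2 char_matrix_def)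
qed

text \<open>An eigenvector of the transpose of \<open>A\<close>, seen as the linear functional \<open>z \<mapsto> a Re z + b Im z\<close> that \<open>A\<close>
  multiplies by \<open>\<mu>\<close>.\<close>

lemma left_eigenvector_2:
  fixes A :: "real mat"
  assumes A: "A \<in> carrier_mat 2 2" and \<mu>: "eigenvalue A \<mu>"
  obtains a b where "(a, b) \<noteq> (0, 0)"
    "\<And>z. a * Re (linear_action A z) + b * Im (linear_action A z) = \<mu> * (a * Re z + b * Im z)"
proof -
  have At: "transpose_mat A \<in> carrier_mat 2 2" using A by simp
  have "eigenvalue (transpose_mat A) \<mu>"
    using \<mu> char_poly_transpose_mat[OF A]
    unfolding eigenvalue_root_char_poly[OF A] eigenvalue_root_char_poly[OF At] by simp
  then obtain v where v: "v \<in> carrier_vec 2" "v \<noteq> 0\<^sub>v 2" "transpose_mat A *\<^sub>v v = \<mu> \<cdot>\<^sub>v v"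
    using A unfolding eigenvalue_def eigenvector_def by auto
  have "(transpose_mat A *\<^sub>v v) $ j = A $$ (0,j) * v $ 0 + A $$ (1,j) * v $ 1" if "j < 2" for j
    using A v(1) that by (auto simp: scalar_prod_def numeral_2_eq_2)
  from this[of 0] this[of 1] have *: "A $$ (0,0) * v $ 0 + A $$ (1,0) * v $ 1 = \<mu> * v $ 0"
    "A $$ (0,1) * v $ 0 + A $$ (1,1) * v $ 1 = \<mu> * v $ 1"
    using v(1) unfolding v(3) by auto
  show ?thesis
  proof (rule that[of "v $ 0" "v $ 1"])
    show "(v $ 0, v $ 1) \<noteq> (0, 0)"
      using v(1,2) by (auto simp: vec_eq_iff less_2_cases_iff)
    fix z
    have "v $ 0 * Re (linear_action A z) + v $ 1 * Im (linear_action A z) =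
        (A $$ (0,0) * v $ 0 + A $$ (1,0) * v $ 1) * Re z + (A $$ (0,1) * v $ 0 + A $$ (1,1) * v $ 1) * Im z"
      by (simp add: linear_action_def algebra_simps)
    then show "v $ 0 * Re (linear_action A z) + v $ 1 * Im (linear_action A z) = \<mu> * (v $ 0 * Re z + v $ 1 * Im z)"
      unfolding * by (simp add: algebra_simps)
  qed
qed

text \<open>The characteristic polynomial is \<open>\<mu>\<^sup>2 - \<tau> \<mu> + 1\<close> with \<open>\<tau>\<close> the trace, and hyperbolicity makes
  its discriminant positive.\<close>

lemma hyperbolic_eigenvalues:
  assumes A: "A \<in> SL2R" and hyp: "hyperbolic A"
  obtains \<mu>1 \<mu>2 :: real where "\<mu>1 \<noteq> \<mu>2" "{\<mu>. eigenvalue A \<mu>} = {\<mu>1, \<mu>2}"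
proof -
  define \<tau> where "\<tau> = A $$ (0,0) + A $$ (1,1)"
  define \<delta> where "\<delta> = sqrt (\<tau>\<^sup>2 - 4)"
  have A2: "A \<in> carrier_mat 2 2" using A by (simp add: SL2R_def)
  have det: "A $$ (0,0) * A $$ (1,1) - A $$ (0,1) * A $$ (1,0) = 1"
    using det_2[OF A2] A by (simp add: SL2R_def)
  have "\<bar>\<tau>\<bar>\<^sup>2 > 2\<^sup>2" using hyp unfolding hyperbolic_def \<tau>_def[symmetric] by (intro power_strict_mono) auto
  then have \<delta>: "\<delta>\<^sup>2 = \<tau>\<^sup>2 - 4" "\<delta> > 0" by (auto simp: \<delta>_def)
  have "eigenvalue A \<mu> \<longleftrightarrow> \<mu> = (\<tau> + \<delta>) / 2 \<or> \<mu> = (\<tau> - \<delta>) / 2" for \<mu>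
  proof -
    have "(A $$ (0,0) - \<mu>) * (A $$ (1,1) - \<mu>) - A $$ (0,1) * A $$ (1,0) = \<mu>\<^sup>2 - \<tau> * \<mu> + 1"
      using det by (simp add: \<tau>_def power2_eq_square algebra_simps)
    also have "\<dots> = (\<mu> - (\<tau> + \<delta>) / 2) * (\<mu> - (\<tau> - \<delta>) / 2)"
      using \<delta>(1) by (simp add: power2_eq_square field_simps)
    finally show ?thesis
      unfolding eigenvalue_2_iff[OF A2] by (simp only: mult_eq_0_iff right_minus_eq)
  qed
  then have "{\<mu>. eigenvalue A \<mu>} = {(\<tau> + \<delta>) / 2, (\<tau> - \<delta>) / 2}" by blast
  moreover have "(\<tau> + \<delta>) / 2 \<noteq> (\<tau> - \<delta>) / 2" using \<delta>(2) by simp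
  ultimately show ?thesis using that by blast
qed

text \<open>The intertwining relation \<open>A H = H M\<^sub>f\<close>, column by column, where \<open>H\<close> is the \<open>2 \<times> 2g\<close> matrix of the
  holonomies of the basis.\<close>

lemma class_holonomy_coords:
  assumes Q: "origami Q" and f: "homeomorphic_map (surface Q) (surface Q) f"
    and fX: "f ` punctured_surface Q = punctured_surface Q" and aff: "affine_with Q A f"
    and c: "Z_basis (homology_group 1 (surface Q)) (2 * genus Q) c" and j: "j < 2 * genus Q"
  shows "linear_action A (class_holonomy Q (c j)) =
    (\<Sum>i<2 * genus Q. of_int (homology_matrix Q c f $$ (i, j)) * class_holonomy Q (c i))"
proof -
  let ?G = "homology_group 1 (surface Q)" and ?n = "2 * genus Q"
  let ?fc = "hom_induced 1 (surface Q) {} (surface Q) {} f (c j)"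
  have cG: "c i \<in> carrier ?G" if "i < ?n" for i using c that by (simp add: Z_basis_def)
  have "?fc \<in> carrier ?G" by (rule hom_induced_carrier)
  then have "class_holonomy Q ?fc = class_holonomy Q (lin_comb ?G ?n c (Z_coords ?G ?n c ?fc))"
    using lin_comb_Z_coords[OF c] by simp
  also have "\<dots> = (\<Sum>i<?n. of_int (Z_coords ?G ?n c ?fc i) * class_holonomy Q (c i))"
    by (rule additive_lin_comb) (use cG in \<open>auto simp: class_holonomy_mult\<close>)
  finally show ?thesis
    using j by (simp add: class_holonomy_hom_induced[OF Q f fX aff cG[OF j]] homology_matrix_def)
qed

text \<open>The holonomy matrix has rank \<open>2\<close>: a functional that vanishes on the holonomies of a basis vanishes on
  those of all classes, and the classes of the horizontal and the vertical crossing cycles have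
  holonomy \<open>n\<close> and \<open>n \<i>\<close>, where \<open>n > 0\<close> is the number of squares.\<close>

lemma functional_vanishing_on_basis:
  assumes Q: "origami Q" and c: "Z_basis (homology_group 1 (surface Q)) n c"
    and zero: "\<And>i. i < n \<Longrightarrow> a * Re (class_holonomy Q (c i)) + b * Im (class_holonomy Q (c i)) = 0"
  shows "a = 0 \<and> b = 0"
proof -
  let ?G = "homology_group 1 (surface Q)"
  have vanish: "a * Re (class_holonomy Q x) + b * Im (class_holonomy Q x) = 0" if x: "x \<in> carrier ?G" for x
  proof -
    have "class_holonomy Q x = (\<Sum>i<n. of_int (Z_coords ?G n c x i) * class_holonomy Q (c i))"
      by (subst lin_comb_Z_coords[OF c x], rule additive_lin_comb)
        (use c in \<open>auto simp: class_holonomy_mult Z_basis_def\<close>)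
    then have "a * Re (class_holonomy Q x) + b * Im (class_holonomy Q x) =
      (\<Sum>i<n. a * (of_int (Z_coords ?G n c x i) * Re (class_holonomy Q (c i)))) +
      (\<Sum>i<n. b * (of_int (Z_coords ?G n c x i) * Im (class_holonomy Q (c i))))"
      by (simp add: sum_distrib_left)
    also have "\<dots> = (\<Sum>i<n. of_int (Z_coords ?G n c x i) * (a * Re (class_holonomy Q (c i)) + b * Im (class_holonomy Q (c i))))"
      unfolding sum.distrib[symmetric] by (rule sum.cong) (auto simp: algebra_simps)
    finally show ?thesis using zero by simp
  qed
  have card: "card (squares Q) \<noteq> 0" using Q by (simp add: origami_def)
  have bij: "bij_betw (right_of Q) (squares Q) (squares Q)" "bij_betw (above Q) (squares Q) (squares Q)"
    using Q by (auto simp: origami_def)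
  obtain x where x: "x \<in> carrier ?G" "class_holonomy Q x = of_nat (card (squares Q)) * 1"
  proof (rule crossing_cycle[OF Q bij(1), of "Complex 0 (1/2)" 1])
    show "glued_point Q (s, Complex 0 (1/2) + 1) = glued_point Q (right_of Q s, Complex 0 (1/2))"
      if "s \<in> squares Q" for s
    proof -
      have "Complex 0 (1/2) + 1 = Complex 1 (1/2)" by (simp add: complex_eq_iff)
      then show ?thesis using glued_point_glue[OF glue.horizontal[OF that, of "1/2"]] by simp
    qed
  qed (auto simp: in_cbox_complex_iff)
  obtain y where y: "y \<in> carrier ?G" "class_holonomy Q y = of_nat (card (squares Q)) * \<i>"
  proof (rule crossing_cycle[OF Q bij(2), of "Complex (1/2) 0" \<i>])
    show "glued_point Q (s, Complex (1/2) 0 + \<i>) = glued_point Q (above Q s, Complex (1/2) 0)"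
      if "s \<in> squares Q" for s
    proof -
      have "Complex (1/2) 0 + \<i> = Complex (1/2) 1" by (simp add: complex_eq_iff)
      then show ?thesis using glued_point_glue[OF glue.vertical[OF that, of "1/2"]] by simp
    qed
  qed (auto simp: in_cbox_complex_iff)
  show ?thesis using vanish[OF x(1)] vanish[OF y(1)] x(2) y(2) card by simp
qed

theorem theorem4p7:
  fixes Q :: "'s origami_data"
    and f :: "('s \<times> complex) set \<Rightarrow> ('s \<times> complex) set"
    and c :: "nat \<Rightarrow> ('s \<times> complex) set chain set"
  assumes "origami Q"
    and "f \<in> Aff_plus Q"
    and "hyperbolic (der Q f)"
    and "Z_basis (homology_group 1 (surface Q)) (2 * genus Q) c"
  shows "\<exists>\<mu>\<^sub>1 \<mu>\<^sub>2 :: real. \<mu>\<^sub>1 \<noteq> \<mu>\<^sub>2 \<and> {\<mu>. eigenvalue (der Q f) \<mu>} = {\<mu>\<^sub>1, \<mu>\<^sub>2} \<and>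
           eigenvalue (map_mat real_of_int (homology_matrix Q c f)) \<mu>\<^sub>1 \<and>
           eigenvalue (map_mat real_of_int (homology_matrix Q c f)) \<mu>\<^sub>2"
proof -
  let ?n = "2 * genus Q"
  let ?M = "map_mat real_of_int (homology_matrix Q c f)"
  obtain A where A: "A \<in> SL2R" "affine_with Q A f" and f: "homeomorphic_map (surface Q) (surface Q) f"
    and fX: "f ` punctured_surface Q = punctured_surface Q"
    using assms(2) unfolding Aff_plus_def by blast
  have der: "der Q f = A" by (rule der_eq[OF assms(1) f fX A])
  have M: "?M \<in> carrier_mat ?n ?n" by (simp add: homology_matrix_def)
  have "eigenvalue ?M \<mu>" if "eigenvalue A \<mu>" for \<mu>
  proof -
    obtain a b where ab: "(a, b) \<noteq> (0, 0)"
      "\<And>z. a * Re (linear_action A z) + b * Im (linear_action A z) = \<mu> * (a * Re z + b * Im z)"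
      using left_eigenvector_2[OF _ \<open>eigenvalue A \<mu>\<close>] A(1) by (auto simp: SL2R_def)
    \<comment> \<open>The pullback of the functional along the holonomy is a left eigenvector of \<open>M\<^sub>f\<close>.\<close>
    define w where "w = vec ?n (\<lambda>j. a * Re (class_holonomy Q (c j)) + b * Im (class_holonomy Q (c j)))"
    have "transpose_mat ?M *\<^sub>v w = \<mu> \<cdot>\<^sub>v w"
    proof (rule eq_vecI)
      fix j assume "j < dim_vec (\<mu> \<cdot>\<^sub>v w)"
      then have j: "j < ?n" by (simp add: w_def)
      have "(transpose_mat ?M *\<^sub>v w) $ j = (\<Sum>i<?n. ?M $$ (i, j) * w $ i)"
        using M j by (simp add: scalar_prod_def w_def atLeast0LessThan)
      also have "\<dots> = a * Re (linear_action A (class_holonomy Q (c j))) +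
          b * Im (linear_action A (class_holonomy Q (c j)))"
        unfolding class_holonomy_coords[OF assms(1) f fX A(2) assms(4) j] using j
        by (simp add: w_def homology_matrix_def sum_distrib_left sum.distrib[symmetric] algebra_simps)
      also have "\<dots> = (\<mu> \<cdot>\<^sub>v w) $ j" using ab(2) j by (simp add: w_def)
      finally show "(transpose_mat ?M *\<^sub>v w) $ j = (\<mu> \<cdot>\<^sub>v w) $ j" .
    qed (simp add: w_def homology_matrix_def)
    moreover have "w \<noteq> 0\<^sub>v ?n"
    proof
      assume "w = 0\<^sub>v ?n"
      then have "a * Re (class_holonomy Q (c i)) + b * Im (class_holonomy Q (c i)) = 0" if "i < ?n" for i
      proof -
        have "w $ i = 0" using \<open>w = 0\<^sub>v ?n\<close> that by simp
        then show ?thesis using that by (simp add: w_def)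
      qed
      then show False using functional_vanishing_on_basis[OF assms(1,4)] ab(1) by blast
    qed
    ultimately have "eigenvalue (transpose_mat ?M) \<mu>"
      unfolding eigenvalue_def eigenvector_def using M by (intro exI[of _ w]) (simp add: w_def)
    then show "eigenvalue ?M \<mu>"
      using char_poly_transpose_mat[OF M] M
      by (simp add: eigenvalue_root_char_poly[of _ ?n])
  qed
  moreover obtain \<mu>1 \<mu>2 where "\<mu>1 \<noteq> \<mu>2" "{\<mu>. eigenvalue A \<mu>} = {\<mu>1, \<mu>2}"
    using hyperbolic_eigenvalues A(1) assms(3) unfolding der by blast
  ultimately show ?thesis unfolding der by blast
qed

end
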